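(* Let $E=\{0,1\}$ and $Q=\begin{pmatrix}-1&1\\1&-1\end{pmatrix}$, and assume $\mathbb{P}(X_0=0)=0$. Then there exist matrices $A_0,A_1\in\mathbb{R}^{2\times 2}$ and positive numbers $a<b$ such that: (1) $A_0$ and $A_1$ are each Hurwitz; (2) $\bar A=\frac12(A_0+A_1)$ is Hurwitz; (3) if the switching rate $r>0$ satisfies $r\notin(a,b)$, then $\|X_t\|\to 0$ almost surely as $t\to\infty$; (4) for some value of the switching rate $r\in(a,b)$, $\|X_t\|\to\infty$ almost surely as $t\to\infty$.
   Context: A matrix is Hurwitz if all its eigenvalues have strictly negative real part. For a switching rate $r>0$, $(I_t)_{t\ge0}$ is the continuous-time (right-continuous jump) Markov process on $E=\{0,1\}$ with generator $rQ$, and $(X_t)_{t\ge0}$ is the $\mathbb{R}^2$-valued solution of $X_t=X_0+\int_0^t A_{I_s}X_s\,ds$ for $t\ge0$, so that $(X_t,I_t)_{t\ge0}$ is a Markov process on $\mathbb{R}^2\times E$. The initial condition $(X_0,I_0)$ has some given law on $\mathbb{R}^2\times E$ with $\mathbb{E}\|X_0\|<\infty$. Here $\|\cdot\|$ is the Euclidean norm. *)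

theory Defs
  imports "HOL-Probability.Probability" "HOL-Library.Numeral_Type"
begin

definition eigenvalue_of :: "real^'n^'n \<Rightarrow> complex \<Rightarrow> bool" where
  "eigenvalue_of A z \<longleftrightarrow> (\<exists>v :: complex^'n. v \<noteq> 0 \<and> map_matrix complex_of_real A *v v = z *s v)"

definition hurwitz :: "real^'n^'n \<Rightarrow> bool" where
  "hurwitz A \<longleftrightarrow> (\<forall>z. eigenvalue_of A z \<longrightarrow> Re z < 0)"

(* The multiplication of the type real^'n^'n is componentwise, so A ^ k would not be the
   matrix power. *)
definition matrix_exp :: "real^'n^'n \<Rightarrow> real^'n^'n" where
  "matrix_exp A = (\<Sum>k. (1 / fact k) *\<^sub>R ((\<lambda>B. A ** B) ^^ k) (mat 1))"

(* Right-continuous paths in a discrete space; the existence of left limits says that only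
   finitely many jumps occur in bounded time. *)
definition jump_path :: "(real \<Rightarrow> 'e) \<Rightarrow> bool" where
  "jump_path p \<longleftrightarrow>
     (\<forall>t\<ge>0. \<forall>\<^sub>F s in at_right t. p s = p t) \<and>
     (\<forall>t>0. \<exists>e. \<forall>\<^sub>F s in at_left t. p s = e)"

(* The sigma-algebra generated by Z and by J u, 0 \<le> u \<le> s. *)
definition past :: "'w measure \<Rightarrow> ('w \<Rightarrow> 'x::topological_space) \<Rightarrow> (real \<Rightarrow> 'w \<Rightarrow> 'e) \<Rightarrow> real \<Rightarrow> 'w measure" where
  "past M Z J s = sigma (space M)
     ({Z -` B \<inter> space M | B. B \<in> sets borel} \<union>
      {J u -` S \<inter> space M | u S. 0 \<le> u \<and> u \<le> s})"

(* Jump Markov process with finite state space 'e and generator L, whose transition matrices are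
   exp (t L). The Markov property is relative to the past of J together with Z: J may start from
   a state correlated with Z, but its later evolution depends on Z only through its own state.
   Below Z is the initial value of X, which makes the pair (X, J) a Markov process. *)
definition jump_markov_process ::
  "'w measure \<Rightarrow> ('w \<Rightarrow> 'x::topological_space) \<Rightarrow> real^'e^'e \<Rightarrow> (real \<Rightarrow> 'w \<Rightarrow> 'e::finite) \<Rightarrow> bool" where
  "jump_markov_process M Z L J \<longleftrightarrow>
     Z \<in> borel_measurable M \<and>
     (\<forall>t\<ge>0. J t \<in> M \<rightarrow>\<^sub>M count_space UNIV) \<and>
     (AE w in M. jump_path (\<lambda>t. J t w)) \<and>
     (\<forall>s\<ge>0. \<forall>t\<ge>0. \<forall>e. AE w in M.
        real_cond_exp M (past M Z J s) (indicator {w \<in> space M. J (s + t) w = e}) w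
          = matrix_exp (t *\<^sub>R L) $ J s w $ e)"

definition switched_solution ::
  "('e \<Rightarrow> real^'n^'n) \<Rightarrow> (real \<Rightarrow> 'e) \<Rightarrow> (real \<Rightarrow> real^'n) \<Rightarrow> bool" where
  "switched_solution A j x \<longleftrightarrow>
     (\<forall>t\<ge>0. ((\<lambda>s. A (j s) *v x s) has_integral (x t - x 0)) {0..t})"

definition switched_process ::
  "'w measure \<Rightarrow> ('e \<Rightarrow> real^'n^'n) \<Rightarrow> real^'e^'e \<Rightarrow> ((real^'n) \<times> 'e) measure \<Rightarrow>
     (real \<Rightarrow> 'w \<Rightarrow> real^'n) \<Rightarrow> (real \<Rightarrow> 'w \<Rightarrow> 'e::finite) \<Rightarrow> bool" where
  "switched_process M A L \<mu> X J \<longleftrightarrow>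
     prob_space M \<and>
     jump_markov_process M (X 0) L J \<and>
     distr M (borel \<Otimes>\<^sub>M count_space UNIV) (\<lambda>w. (X 0 w, J 0 w)) = \<mu> \<and>
     (AE w in M. switched_solution A (\<lambda>t. J t w) (\<lambda>t. X t w))"

(* E = {0,1} is the two-element type 2. *)
definition switch_matrix :: "real^2^2" where
  "switch_matrix = (\<chi> i j. if i = j then -1 else 1)"

definition two_matrices :: "real^'n^'n \<Rightarrow> real^'n^'n \<Rightarrow> 2 \<Rightarrow> real^'n^'n" where
  "two_matrices A0 A1 = (\<lambda>i. if i = 0 then A0 else A1)"

end

theory Submission
  imports Defs
begin

text \<open>Both matrices are spirals around the origin with a slight common decay, \<open>A\<^sub>i = 4 J + \<epsilon>\<^sub>i H - 1/128\<close> with the rotation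
generator \<open>J\<close>, \<open>H = diag(1, -1)\<close> and \<open>\<epsilon>\<^sub>0 = 1\<close>, \<open>\<epsilon>\<^sub>1 = -1\<close>. Without the decay either flow runs along
ellipses, and the two families of ellipses have their axes exchanged. Under very slow switching the rare jumps
between ellipses gain little, under very fast switching only the mean rotation is seen; in both regimes the decay wins.
When the switching rate is comparable to the angular velocity, however, the products of the elliptic rotations grow
exponentially, and faster than the decay.

All three regimes are treated by one criterion, the locale \<open>switched_lyapunov\<close>: if positive functions \<open>W\<^sub>0\<close>, \<open>W\<^sub>1\<close>
of the position satisfy \<open>W\<^sub>i' A\<^sub>i x + r (W\<^sub>1\<^sub>-\<^sub>i - W\<^sub>i) \<le> - \<beta> W\<^sub>i\<close>, then \<open>W\<close> tends to 0 along almost every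
trajectory (\<open>lyapunov_function_tendsto_0\<close>). For slow and fast switching \<open>W\<close> is a positive
definite quadratic form, so the process tends to 0 (\<open>slow_lyapunov\<close>, \<open>fast_lyapunov\<close>). For rate 4 it behaves like a negative
power of the norm, so the norm tends to infinity (\<open>intermediate_lyapunov\<close>).

The criterion is proved through the Euler scheme. On a grid of width \<open>h\<close> the scheme is an explicit function of the initial
value and of finitely many values of the index process, so the transition probabilities alone show that the expectation of \<open>W\<close>
decreases by the factor \<open>exp (- \<beta> h / 2)\<close> in each step (\<open>expected_euler_decrease\<close>). Paths have finitely many
jumps in bounded time, so the scheme converges to the solution as \<open>h \<rightarrow> 0\<close> (\<open>euler_convergence\<close>), and Fatou's lemma yields
exponential decay of the expectation of \<open>W\<close> along the process itself. Summability over a grid of times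
gives almost sure convergence there, and between grid times the norm changes by at most a factor 2.\<close>

section \<open>Transition probabilities of the two-state process\<close>

lemma two_cases: "(i::2) = 0 \<or> i = 1" using exhaust_2[of i] by auto

lemma sum_over_2: "(\<Sum>i\<in>UNIV. f (i::2)) = f i + f (1 - i)"
  for f :: "2 \<Rightarrow> 'a::comm_monoid_add"
proof -
  have "UNIV = {i, 1 - i}" "i \<noteq> 1 - i"
    using two_cases[of i] UNIV_2 by auto
  then have "sum f UNIV = sum f {i, 1 - i}" by metis
  then show ?thesis using \<open>i \<noteq> 1 - i\<close> by simp
qed

lemma switch_matrix_square: "switch_matrix ** switch_matrix = (-2) *\<^sub>R switch_matrix"
  by (simp add: vec_eq_iff matrix_matrix_mult_def switch_matrix_def sum_over_2[where i=0] forall_2)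

text \<open>Since \<open>Q\<^sup>2 = -2 Q\<close>, the matrix \<open>- Q / 2\<close> is the projection onto the eigenvalue \<open>-2\<close> and
\<open>1 + Q / 2\<close> the complementary one, onto the kernel. This splits every power, hence also the exponential.\<close>

lemma switch_matrix_power:
  "((\<lambda>B. (c *\<^sub>R switch_matrix) ** B) ^^ k) (mat 1)
     = (- (1/2) * (-2*c)^k) *\<^sub>R switch_matrix + (if k = 0 then mat 1 + (1/2) *\<^sub>R switch_matrix else 0)"
proof (induction k)
  case 0
  show ?case by simp
next
  case (Suc k)
  have a: "(c *\<^sub>R switch_matrix) ** (b *\<^sub>R switch_matrix) = (-2 * c * b) *\<^sub>R switch_matrix" for b
    by (simp add: vec_eq_iff matrix_matrix_mult_def switch_matrix_def sum_over_2[where i=0] forall_2)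
  have half: "(mat 1 + (1/2) *\<^sub>R switch_matrix :: real^2^2) = (\<chi> i j. 1/2)"
    by (simp add: vec_eq_iff mat_def switch_matrix_def)
  have b: "(c *\<^sub>R switch_matrix) ** (mat 1 + (1/2) *\<^sub>R switch_matrix) = 0"
    unfolding half
    by (simp add: vec_eq_iff matrix_matrix_mult_def switch_matrix_def sum_over_2[where i=0] forall_2)
  show ?case
    using Suc by (cases "k = 0") (simp_all add: matrix_add_ldistrib a b a[of "- _", simplified])
qed

lemma matrix_exp_switch:
  "matrix_exp (c *\<^sub>R switch_matrix) $ i $ j
     = (if i = j then 1 - (1 - exp (-2*c)) / 2 else (1 - exp (-2*c)) / 2)"
proof -
  let ?P = "mat 1 + (1/2) *\<^sub>R switch_matrix :: real^2^2"
  have "(\<lambda>k. (1 / fact k) * (-2*c)^k) sums exp (-2*c)"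
    using exp_converges[of "-2*c"] by (simp add: divide_inverse)
  then have 1: "(\<lambda>k. (- (1/2) * ((1 / fact k) * (-2*c)^k)) *\<^sub>R switch_matrix)
      sums ((- (1/2) * exp (-2*c)) *\<^sub>R switch_matrix)"
    by (intro sums_scaleR_left sums_mult)
  have 2: "(\<lambda>k. if k = 0 then ?P else 0) sums ?P"
    using sums_single[of 0 "\<lambda>_. ?P"] by simp
  have "(\<lambda>k. (1 / fact k) *\<^sub>R ((\<lambda>B. (c *\<^sub>R switch_matrix) ** B) ^^ k) (mat 1))
      sums ((- (1/2) * exp (-2*c)) *\<^sub>R switch_matrix + ?P)"
    unfolding switch_matrix_power
    by (rule sums_cong[THEN iffD1, OF _ sums_add[OF 1 2]]) (simp add: algebra_simps)
  then have "matrix_exp (c *\<^sub>R switch_matrix) = (- (1/2) * exp (-2*c)) *\<^sub>R switch_matrix + ?P"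
    unfolding matrix_exp_def by (rule sums_unique[symmetric])
  then show ?thesis by (simp add: switch_matrix_def mat_def diff_divide_distrib)
qed

section \<open>The Euler scheme along a path with jumps\<close>

text \<open>The explicit Euler scheme reads the switching path only at the grid points \<open>k h\<close>. Along this scheme
expectations can therefore be computed from the transition probabilities at finitely many times, and no
information about the path between grid points enters until the limit \<open>h \<rightarrow> 0\<close>.\<close>

primrec euler ::
  "('e \<Rightarrow> real^'n^'n) \<Rightarrow> real \<Rightarrow> (real \<Rightarrow> 'e) \<Rightarrow> real^'n \<Rightarrow> nat \<Rightarrow> real^'n" where
  "euler A h p x 0 = x"
| "euler A h p x (Suc k) = euler A h p x k + h *\<^sub>R (A (p (real k * h)) *v euler A h p x k)"

lemma switched_solution_integral:
  assumes sol: "switched_solution A p x" and "0 \<le> s" "s \<le> t"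
  shows "((\<lambda>u. A (p u) *v x u) has_integral (x t - x s)) {s..t}"
proof -
  let ?g = "\<lambda>u. A (p u) *v x u"
  have 1: "(?g has_integral (x s - x 0)) {0..s}" and 2: "(?g has_integral (x t - x 0)) {0..t}"
    using assms unfolding switched_solution_def by auto
  have "?g integrable_on {s..t}"
    by (rule integrable_subinterval_real[of _ 0 t]) (use 2 assms in \<open>auto simp: integrable_on_def\<close>)
  then obtain j where j: "(?g has_integral j) {s..t}" by (auto simp: integrable_on_def)
  have "(?g has_integral (x s - x 0) + j) {0..t}"
    by (rule has_integral_combine[OF _ _ 1 j]) (use assms in auto)
  then have "(x s - x 0) + j = x t - x 0" using 2 has_integral_unique by blast
  then have "j = x t - x s" by (simp add: algebra_simps)
  then show ?thesis using j by simp
qed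

lemma switched_solution_continuous:
  assumes sol: "switched_solution A p x" and "0 \<le> s"
  shows "continuous_on {s..t} x"
proof (cases "s \<le> t")
  case True
  let ?g = "\<lambda>u. A (p u) *v x u"
  have "?g integrable_on {s..t}"
    using switched_solution_integral[OF sol \<open>0 \<le> s\<close> True] by (auto simp: integrable_on_def)
  then have "continuous_on {s..t} (\<lambda>u. x s + integral {s..u} ?g)"
    by (intro continuous_intros indefinite_integral_continuous_1)
  moreover have "x s + integral {s..u} ?g = x u" if "u \<in> {s..t}" for u
    using switched_solution_integral[OF sol \<open>0 \<le> s\<close>, of u] that by (simp add: integral_unique)
  ultimately show ?thesis by (metis (no_types, lifting) continuous_on_cong)
qed auto

text \<open>On a time interval of length at most \<open>1 / (2 C)\<close> the largest value of \<open>norm x\<close> is at most twice the value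
at the left end, because the integral equation lets it exceed that value by at most half of itself. This
replaces Gronwall's inequality throughout.\<close>

lemma switched_solution_increment:
  assumes sol: "switched_solution A p x" and bnd: "\<And>e v. norm (A e *v v) \<le> C * norm v"
    and C: "0 \<le> C" and st: "0 \<le> s" "s \<le> t" "2 * C * (t - s) \<le> 1"
  shows "norm (x t - x s) \<le> 2 * C * (t - s) * norm (x s)"
proof -
  have "continuous_on {s..t} (\<lambda>u. norm (x u))"
    by (intro continuous_intros switched_solution_continuous[OF sol \<open>0 \<le> s\<close>])
  then obtain u0 where u0: "u0 \<in> {s..t}" and mx: "\<And>u. u \<in> {s..t} \<Longrightarrow> norm (x u) \<le> norm (x u0)"
    using continuous_attains_sup[of "{s..t}" "\<lambda>u. norm (x u)"] st by (metis atLeastatMost_empty_iff2 compact_Icc linorder_not_le not_le)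
  have inc: "norm (x u - x s) \<le> C * norm (x u0) * (u - s)" if "u \<in> {s..t}" for u
  proof -
    have "norm (x u - x s) \<le> C * norm (x u0) * measure lborel {s..u}"
    proof (rule has_integral_bound_real[OF _ finite.emptyI switched_solution_integral[OF sol]])
      show "norm (A (p v) *v x v) \<le> C * norm (x u0)" if "v \<in> {s..u} - {}" for v
        using bnd[of "p v" "x v"] mx[of v] that \<open>u \<in> {s..t}\<close> C
        by (smt (verit) DiffE atLeastAtMost_iff mult_left_mono)
    qed (use that st C in auto)
    then show ?thesis using that by simp
  qed
  have "norm (x u0 - x s) \<le> C * (t - s) * norm (x u0)"
    using inc[OF u0] u0 C by (smt (verit) atLeastAtMost_iff mult.assoc mult.commute mult_left_mono norm_ge_zero zero_le_mult_iff)
  also have "\<dots> \<le> (1/2) * norm (x u0)"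
    using st by (intro mult_right_mono) auto
  finally have "norm (x u0) \<le> 2 * norm (x s)"
    using norm_triangle_ineq2[of "x u0" "x s"] by simp
  then have "C * norm (x u0) * (t - s) \<le> C * (2 * norm (x s)) * (t - s)"
    using C st by (intro mult_right_mono mult_left_mono) auto
  moreover have "norm (x t - x s) \<le> C * norm (x u0) * (t - s)" using inc[of t] st by simp
  ultimately have "norm (x t - x s) \<le> C * (2 * norm (x s)) * (t - s)" by (rule order_trans[rotated])
  then show ?thesis by (simp only: mult_ac)
qed

text \<open>Around every time \<open>t\<close> the path is constant on the left and constant on the right, so \<open>t\<close> is the only possible
jump in a neighbourhood; by compactness finitely many such \<open>t\<close> account for all jumps. The interval \<open>{a<..b}\<close> is
open at \<open>a\<close> because a right-continuous path that jumps at \<open>a\<close> already has its new value there.\<close>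

lemma jump_path_finite_jumps:
  assumes "jump_path p" 
  obtains D where "finite D"
    "\<And>a b u. \<lbrakk>0 \<le> a; b \<le> T; {a<..b} \<inter> D = {}; u \<in> {a..b}\<rbrakk> \<Longrightarrow> p u = p a"
proof -
  have "\<exists>\<epsilon>>0. (\<forall>u\<in>{t<..<t+\<epsilon>}. p u = p t) \<and> (\<exists>e. \<forall>u\<in>{t-\<epsilon><..<t}. 0 \<le> u \<longrightarrow> p u = e)" if "0 \<le> t" for t
  proof -
    have "\<forall>\<^sub>F s in at_right t. p s = p t" using assms that by (simp add: jump_path_def)
    then obtain c where c: "c > t" "\<And>u. \<lbrakk>t < u; u < c\<rbrakk> \<Longrightarrow> p u = p t"
      unfolding eventually_at_right_field by auto
    obtain b e where b: "b < t" "\<And>u. \<lbrakk>b < u; u < t; 0 \<le> u\<rbrakk> \<Longrightarrow> p u = e"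
    proof (cases "t = 0")
      case True
      then show ?thesis using that[of "-1"] by auto
    next
      case False
      then obtain e where "\<forall>\<^sub>F s in at_left t. p s = e"
        using assms \<open>0 \<le> t\<close> unfolding jump_path_def by (metis order_le_less)
      then show ?thesis using that unfolding eventually_at_left_field by auto
    qed
    show ?thesis
      by (rule exI[of _ "min (c - t) (t - b)"]) (use b c in \<open>auto simp: min_def split: if_splits\<close>)
  qed
  then obtain \<epsilon> where \<epsilon>: "\<And>t. 0 \<le> t \<Longrightarrow> 0 < \<epsilon> t"
    and right: "\<And>t u. \<lbrakk>0 \<le> t; u \<in> {t<..<t+\<epsilon> t}\<rbrakk> \<Longrightarrow> p u = p t"
    and left: "\<And>t. 0 \<le> t \<Longrightarrow> \<exists>e. \<forall>u\<in>{t-\<epsilon> t<..<t}. 0 \<le> u \<longrightarrow> p u = e"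
    by metis
  have "{0..T} \<subseteq> (\<Union>t\<in>{0..T}. {t - \<epsilon> t<..<t + \<epsilon> t})" using \<epsilon> by force
  then obtain D where D: "D \<subseteq> {0..T}" "finite D" "{0..T} \<subseteq> (\<Union>t\<in>D. {t - \<epsilon> t<..<t + \<epsilon> t})"
    by (rule compactE_image[OF compact_Icc, rotated]) auto
  have loc: "\<exists>\<eta>>0. \<forall>u\<in>{0..T}. \<bar>u - s\<bar> < \<eta> \<longrightarrow> p u = p s" if s: "s \<in> {0..T}" "s \<notin> D" for s
  proof -
    obtain t where t: "t \<in> D" "s \<in> {t - \<epsilon> t<..<t + \<epsilon> t}" using D s by blast
    then have "t \<noteq> s" "0 \<le> t" using s D by auto
    then consider "s < t" | "t < s" by linarith
    then show ?thesis
    proof cases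
      case 1
      then show ?thesis using left[OF \<open>0 \<le> t\<close>] t s
        by (intro exI[of _ "min (t - s) (s - (t - \<epsilon> t))"]) (auto simp: abs_less_iff)
    next
      case 2
      then show ?thesis using right[OF \<open>0 \<le> t\<close>] t s
        by (intro exI[of _ "min (s - t) (t + \<epsilon> t - s)"]) (auto simp: abs_less_iff)
    qed
  qed
  show ?thesis
  proof (rule that[OF D(2)])
    fix a b u assume *: "0 \<le> a" "b \<le> T" "{a<..b} \<inter> D = {}" "u \<in> {a..b}"
    show "p u = p a"
    proof (rule connected_local_const[of "{a..b}"])
      show "\<forall>s\<in>{a..b}. \<forall>\<^sub>F v in at s within {a..b}. p s = p v"
      proof
        fix s assume s: "s \<in> {a..b}"
        show "\<forall>\<^sub>F v in at s within {a..b}. p s = p v"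
        proof (cases "s = a")
          case True
          have "p a = p v" if "v \<in> {a..b}" "v \<noteq> a" "dist v a < \<epsilon> a" for v
            using right[of a v] that *(1) by (simp add: dist_real_def)
          then show ?thesis unfolding eventually_at True using \<epsilon>[OF *(1)] by blast
        next
          case False
          then have "s \<in> {0..T}" "s \<notin> D" using *(1-3) s by (auto simp: disjoint_iff)
          then obtain \<eta> where \<eta>: "\<eta> > 0" "\<And>u. \<lbrakk>u \<in> {0..T}; \<bar>u - s\<bar> < \<eta>\<rbrakk> \<Longrightarrow> p u = p s"
            using loc[of s] by blast
          have "p s = p v" if "v \<in> {a..b}" "dist v s < \<eta>" for v
            using \<eta>(2)[of v] that *(1,2) by (simp add: dist_real_def)
          then show ?thesis unfolding eventually_at using \<eta>(1) by blast
        qed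
      qed
    qed (use * in auto)
  qed
qed

text \<open>Without a jump the velocity is a fixed linear function of the position, and the position stays within \<open>O(h)\<close> of
its value at the start of the step; this gains a second factor \<open>h\<close>.\<close>

lemma euler_local_error:
  assumes sol: "switched_solution A p x" and bnd: "\<And>e v. norm (A e *v v) \<le> C * norm v"
    and C: "0 \<le> C" and s: "0 \<le> s" "0 \<le> h" "2 * C * h \<le> 1"
  defines "d \<equiv> norm (x (s + h) - x s - h *\<^sub>R (A (p s) *v x s))"
  shows "d \<le> 3 * C * h * norm (x s)"
    and "(\<And>u. u \<in> {s..s+h} \<Longrightarrow> p u = p s) \<Longrightarrow> d \<le> 2 * C\<^sup>2 * h\<^sup>2 * norm (x s)"
proof -
  have "d \<le> norm (x (s + h) - x s) + norm (h *\<^sub>R (A (p s) *v x s))"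
    unfolding d_def by (rule norm_triangle_ineq4)
  moreover have "norm (x (s + h) - x s) \<le> 2 * C * h * norm (x s)"
    using switched_solution_increment[OF sol bnd C, of s "s+h"] s by simp
  moreover have "norm (h *\<^sub>R (A (p s) *v x s)) \<le> h * (C * norm (x s))"
    using bnd[of "p s" "x s"] s by (simp add: mult_left_mono)
  ultimately show "d \<le> 3 * C * h * norm (x s)" by (simp add: algebra_simps)
next
  assume const: "\<And>u. u \<in> {s..s+h} \<Longrightarrow> p u = p s"
  let ?c = "A (p s) *v x s"
  have "((\<lambda>u. ?c) has_integral h *\<^sub>R ?c) {s..s+h}"
    using has_integral_const_real[of ?c s "s+h"] s by simp
  then have int: "((\<lambda>u. A (p u) *v x u - ?c) has_integral (x (s+h) - x s - h *\<^sub>R ?c)) {s..s+h}"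
    by (intro has_integral_diff switched_solution_integral[OF sol]) (use s in auto)
  have "d \<le> (2 * C\<^sup>2 * h * norm (x s)) * measure lborel {s..s+h}"
    unfolding d_def
  proof (rule has_integral_bound_real[OF _ finite.emptyI int])
    fix u assume u: "u \<in> {s..s+h} - {}"
    have "2 * C * (u - s) \<le> 2 * C * h" using u C by (intro mult_left_mono) auto
    then have "norm (x u - x s) \<le> 2 * C * (u - s) * norm (x s)"
      using switched_solution_increment[OF sol bnd C, of s u] u s by simp
    also have "\<dots> \<le> 2 * C * h * norm (x s)"
      using \<open>2 * C * (u - s) \<le> 2 * C * h\<close> by (rule mult_right_mono) auto
    finally have "C * norm (x u - x s) \<le> C * (2 * C * h * norm (x s))"
      using C by (rule mult_left_mono)
    moreover have "A (p u) *v x u - ?c = A (p s) *v (x u - x s)"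
      using const[of u] u by (simp add: matrix_vector_mult_diff_distrib)
    ultimately show "norm (A (p u) *v x u - ?c) \<le> 2 * C\<^sup>2 * h * norm (x s)"
      using bnd[of "p s" "x u - x s"] by (simp add: power2_eq_square mult_ac)
  qed (use s C in auto)
  then show "d \<le> 2 * C\<^sup>2 * h\<^sup>2 * norm (x s)"
    using s by (simp add: power2_eq_square mult_ac)
qed

lemma euler_global_error:
  assumes bnd: "\<And>e v. norm (A e *v v) \<le> C * norm v" and C: "0 \<le> C" and h: "0 \<le> h"
  shows "norm (x (real k * h) - euler A h p (x 0) k)
    \<le> (1 + C * h) ^ k * (\<Sum>j<k. norm (x (real j * h + h) - x (real j * h) - h *\<^sub>R (A (p (real j * h)) *v x (real j * h))))"
proof (induction k)
  case 0
  then show ?case by simp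
next
  case (Suc k)
  define s where "s = real k * h"
  define y where "y = euler A h p (x 0) k"
  define d where "d j = norm (x (real j * h + h) - x (real j * h) - h *\<^sub>R (A (p (real j * h)) *v x (real j * h)))" for j
  have IH: "norm (x s - y) \<le> (1 + C * h) ^ k * (\<Sum>j<k. d j)"
    using Suc unfolding d_def s_def y_def .
  have "x (real (Suc k) * h) - euler A h p (x 0) (Suc k)
     = (x (s + h) - x s - h *\<^sub>R (A (p s) *v x s)) + (x s - y) + h *\<^sub>R (A (p s) *v (x s - y))"
    by (simp add: s_def y_def matrix_vector_mult_diff_distrib algebra_simps)
  also have "norm \<dots> \<le> d k + norm (x s - y) + h * (C * norm (x s - y))"
    unfolding d_def s_def[symmetric]
    by (intro norm_triangle_mono add_mono) (use bnd h in \<open>auto intro!: mult_left_mono\<close>)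
  also have "\<dots> = d k + (1 + C * h) * norm (x s - y)" by (simp add: algebra_simps)
  also have "\<dots> \<le> (1 + C * h) ^ Suc k * d k + (1 + C * h) * ((1 + C * h) ^ k * (\<Sum>j<k. d j))"
  proof (rule add_mono)
    have "1 \<le> (1 + C * h) ^ Suc k" using C h by (intro one_le_power) auto
    then show "d k \<le> (1 + C * h) ^ Suc k * d k"
      using mult_right_mono[of 1 _ "d k"] by (simp add: d_def)
    show "(1 + C * h) * norm (x s - y) \<le> (1 + C * h) * ((1 + C * h) ^ k * (\<Sum>j<k. d j))"
      using IH C h by (intro mult_left_mono) auto
  qed
  finally show ?case by (simp add: d_def algebra_simps)
qed

text \<open>Of the \<open>T / h\<close> steps only boundedly many contain a jump. Their errors contribute \<open>O(h)\<close>, and so do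
the \<open>O(h\<^sup>2)\<close> errors of all the other steps.\<close>

lemma euler_convergence:
  assumes sol: "switched_solution A p x" and p: "jump_path p"
    and bnd: "\<And>e v. norm (A e *v v) \<le> C * norm v" and C: "0 \<le> C"
    and h: "\<And>n. 0 < h n" "h \<longlonglongrightarrow> 0" and k: "\<And>n. real (k n) * h n = T"
  shows "(\<lambda>n. euler A (h n) p (x 0) (k n)) \<longlonglongrightarrow> x T"
proof -
  have T: "0 \<le> T" using h(1)[of 0] k[of 0] by (metis less_eq_real_def mult_nonneg_nonneg of_nat_0_le_iff)
  obtain D where D: "finite D"
    "\<And>a b u. \<lbrakk>0 \<le> a; b \<le> T; {a<..b} \<inter> D = {}; u \<in> {a..b}\<rbrakk> \<Longrightarrow> p u = p a"
    using jump_path_finite_jumps[OF p, of T] by metis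
  have "compact (x ` {0..T})"
    by (intro compact_continuous_image switched_solution_continuous[OF sol]) auto
  then obtain B where B: "\<And>u. u \<in> {0..T} \<Longrightarrow> norm (x u) \<le> B"
    by (meson bounded_iff compact_imp_bounded imageI)
  have B0: "0 \<le> B" using B[of 0] T by (smt (verit) atLeastAtMost_iff norm_ge_zero)
  define E where "E = exp (C * T) * (2 * C\<^sup>2 * T * B + 3 * C * B * real (card D))"
  have main: "norm (x T - euler A (h n) p (x 0) (k n)) \<le> E * h n" if hn: "2 * C * h n \<le> 1" for n
  proof -
    let ?h = "h n" and ?k = "k n"
    define d where "d j = norm (x (real j * ?h + ?h) - x (real j * ?h) - ?h *\<^sub>R (A (p (real j * ?h)) *v x (real j * ?h)))" for j
    define bad where "bad = {j. j < ?k \<and> {real j * ?h<..real j * ?h + ?h} \<inter> D \<noteq> {}}"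
    have le: "real j * ?h + ?h \<le> T" if "j < ?k" for j
    proof -
      have "real (Suc j) * ?h \<le> real ?k * ?h" using that h(1)[of n] by (intro mult_right_mono) auto
      then show ?thesis using k[of n] by (simp add: algebra_simps)
    qed
    have dj: "d j \<le> 2 * C\<^sup>2 * ?h\<^sup>2 * B + (if j \<in> bad then 3 * C * ?h * B else 0)" if j: "j < ?k" for j
    proof -
      have jB: "norm (x (real j * ?h)) \<le> B" using le[OF j] h(1)[of n] by (intro B) auto
      have nn: "0 \<le> 2 * C\<^sup>2 * ?h\<^sup>2 * B" using C B0 by simp
      show ?thesis
      proof (cases "j \<in> bad")
        case True
        have "d j \<le> 3 * C * ?h * norm (x (real j * ?h))"
          unfolding d_def using h(1)[of n] hn by (intro euler_local_error(1)[OF sol bnd C]) auto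
        also have "\<dots> \<le> 3 * C * ?h * B" using jB C h(1)[of n] by (intro mult_left_mono) auto
        finally show ?thesis using nn by (simp only: True if_True)
      next
        case False
        then have "{real j * ?h<..real j * ?h + ?h} \<inter> D = {}" using j by (simp add: bad_def)
        then have const: "p u = p (real j * ?h)" if "u \<in> {real j * ?h..real j * ?h + ?h}" for u
          using D(2)[OF _ le[OF j] _ that] h(1)[of n] by simp
        have "d j \<le> 2 * C\<^sup>2 * ?h\<^sup>2 * norm (x (real j * ?h))"
          unfolding d_def
          by (rule euler_local_error(2)[OF sol bnd C _ _ hn const]) (use h(1)[of n] in auto)
        also have "\<dots> \<le> 2 * C\<^sup>2 * ?h\<^sup>2 * B" using jB C by (intro mult_left_mono) auto
        finally show ?thesis using False by simp
      qed
    qed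
    \<comment> \<open>A bad step is determined by any jump in it, so there are at most as many bad steps as jumps.\<close>
    have "bad \<subseteq> (\<lambda>t. nat (\<lceil>t / ?h\<rceil> - 1)) ` D"
    proof
      fix j assume "j \<in> bad"
      then obtain t where t: "t \<in> D" "real j * ?h < t" "t \<le> real j * ?h + ?h" by (auto simp: bad_def)
      then have "real j < t / ?h" "t / ?h \<le> real j + 1"
        using h(1)[of n] by (simp_all add: field_simps)
      then have "\<lceil>t / ?h\<rceil> = int j + 1" by (simp add: ceiling_eq_iff)
      then show "j \<in> (\<lambda>t. nat (\<lceil>t / ?h\<rceil> - 1)) ` D" using t by force
    qed
    then have cb: "card bad \<le> card D" using D(1) surj_card_le by blast
    have "(\<Sum>j<?k. d j) \<le> (\<Sum>j<?k. 2 * C\<^sup>2 * ?h\<^sup>2 * B + (if j \<in> bad then 3 * C * ?h * B else 0))"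
      using dj by (intro sum_mono) auto
    also have "\<dots> = real ?k * (2 * C\<^sup>2 * ?h\<^sup>2 * B) + real (card ({..<?k} \<inter> bad)) * (3 * C * ?h * B)"
      by (simp add: sum.distrib sum.If_cases)
    also have "{..<?k} \<inter> bad = bad" by (auto simp: bad_def)
    also have "real (card bad) * (3 * C * ?h * B) \<le> real (card D) * (3 * C * ?h * B)"
      using cb C B0 h(1)[of n] by (intro mult_right_mono) auto
    also have "real ?k * (2 * C\<^sup>2 * ?h\<^sup>2 * B) = 2 * C\<^sup>2 * (real ?k * ?h) * ?h * B"
      by (simp add: power2_eq_square)
    finally have sum: "(\<Sum>j<?k. d j) \<le> ?h * (2 * C\<^sup>2 * T * B + 3 * C * B * real (card D))"
      unfolding k by (simp add: algebra_simps)
    have "(1 + C * ?h) ^ ?k \<le> exp (C * ?h) ^ ?k"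
      using C h(1)[of n] by (intro power_mono) auto
    also have "\<dots> = exp (C * T)"
      unfolding exp_of_nat_mult[symmetric] using k[of n] by (simp add: mult.left_commute)
    finally have pw: "(1 + C * ?h) ^ ?k \<le> exp (C * T)" .
    have "norm (x (real ?k * ?h) - euler A ?h p (x 0) ?k) \<le> (1 + C * ?h) ^ ?k * (\<Sum>j<?k. d j)"
      unfolding d_def using h(1)[of n] by (intro euler_global_error[OF bnd C]) auto
    also have "\<dots> \<le> exp (C * T) * (?h * (2 * C\<^sup>2 * T * B + 3 * C * B * real (card D)))"
      using pw sum by (intro mult_mono) (auto simp: d_def sum_nonneg)
    finally show ?thesis unfolding k E_def by (simp add: mult_ac)
  qed
  have "(\<lambda>n. 2 * C * h n) \<longlonglongrightarrow> 2 * C * 0" by (intro tendsto_intros h)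
  then have "\<forall>\<^sub>F n in sequentially. 2 * C * h n < 1" by (rule order_tendstoD) simp
  then have ev: "\<forall>\<^sub>F n in sequentially. norm (euler A (h n) p (x 0) (k n) - x T) \<le> E * h n"
    by (rule eventually_mono) (use main in \<open>simp add: norm_minus_commute\<close>)
  have "(\<lambda>n. E * h n) \<longlonglongrightarrow> E * 0" by (intro tendsto_intros h)
  then have "(\<lambda>n. euler A (h n) p (x 0) (k n) - x T) \<longlonglongrightarrow> 0"
    by (intro Lim_null_comparison[OF ev]) simp
  then show ?thesis by (simp add: LIM_zero_iff)
qed

section \<open>One Euler step and the generator\<close>

text \<open>The functions \<open>W 0\<close> and \<open>W 1\<close> are the two components of a Lyapunov function on the product of the
space of positions and the set of indices: the last assumption bounds the generator of the joint process applied to \<open>W\<close> by \<open>- \<beta> W\<close>.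
The bounds with \<open>K\<close> hold for functions that are homogeneous of some degree, positive or negative, and
they make first-order expansions uniform up to the singularity at the origin. Smallness of \<open>W\<close> may therefore mean
that the process is near the origin or that it is far away; both cases are used below.\<close>

locale switched_lyapunov =
  fixes A :: "2 \<Rightarrow> real^'n^'n" and C r \<beta> K :: real
    and W :: "2 \<Rightarrow> real^'n \<Rightarrow> real" and G :: "2 \<Rightarrow> real^'n \<Rightarrow> real^'n"
  assumes norm_A: "\<And>i x. norm (A i *v x) \<le> C * norm x"
    and C_pos: "0 < C" and r_pos: "0 < r" and \<beta>_pos: "0 < \<beta>"
    and W_pos: "\<And>i x. x \<noteq> 0 \<Longrightarrow> 0 < W i x"
    and W_measurable [measurable]: "\<And>i. W i \<in> borel_measurable borel"
    and W_deriv: "\<And>i x. x \<noteq> 0 \<Longrightarrow> (W i has_derivative (\<lambda>v. G i x \<bullet> v)) (at x)"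
    and G_bound: "\<And>i x. x \<noteq> 0 \<Longrightarrow> norm (G i x) * norm x \<le> K * W i x"
    and W_comparable: "\<And>i j x. x \<noteq> 0 \<Longrightarrow> W i x \<le> K * W j x"
    and generator: "\<And>i x. x \<noteq> 0 \<Longrightarrow>
       G i x \<bullet> (A i *v x) + r * (W (1 - i) x - W i x) \<le> - \<beta> * W i x"
begin

definition switch_prob :: "real \<Rightarrow> real" where
  "switch_prob t = (1 - exp (- 2 * r * t)) / 2"

lemma switch_prob_bounds:
  assumes "0 \<le> t" shows "0 \<le> switch_prob t" "switch_prob t \<le> r * t" "switch_prob t \<le> 1"
proof -
  show "0 \<le> switch_prob t" using assms r_pos by (simp add: switch_prob_def)
  show "switch_prob t \<le> r * t" using exp_ge_add_one_self[of "- 2 * r * t"] by (simp add: switch_prob_def field_simps)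
  show "switch_prob t \<le> 1" by (simp add: switch_prob_def field_simps add_increasing)
qed

lemma K_pos: "0 < K"
proof -
  obtain x :: "real^'n" where "x \<noteq> 0" using zero_neq_one by blast
  then have "0 < W 0 x" "W 0 x \<le> K * W 0 x" using W_comparable W_pos by auto
  then show ?thesis by (metis less_le_trans zero_less_mult_pos2)
qed

lemma euler_segment:
  assumes x: "x \<noteq> 0" and t: "0 \<le> t" "2 * C * t \<le> 1"
  shows "norm x \<le> 2 * norm (x + t *\<^sub>R (A i *v x))" "x + t *\<^sub>R (A i *v x) \<noteq> 0"
proof -
  have "norm (t *\<^sub>R (A i *v x)) \<le> t * (C * norm x)"
    using norm_A[of i x] t by (simp add: mult_left_mono)
  also have "\<dots> = (C * t) * norm x" by simp
  also have "\<dots> \<le> (1/2) * norm x" using t by (intro mult_right_mono) auto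
  finally show a: "norm x \<le> 2 * norm (x + t *\<^sub>R (A i *v x))"
    using norm_triangle_ineq4[of "x + t *\<^sub>R (A i *v x)" "t *\<^sub>R (A i *v x)"] by simp
  show "x + t *\<^sub>R (A i *v x) \<noteq> 0" using a x by auto
qed

text \<open>The three bounds make, respectively, the Euler step move a vector by at most half of its norm, the jump correction
to \<open>W\<close> at most \<open>W / 2\<close>, and the first-order error terms at most \<open>\<beta> W / 4\<close>.\<close>

definition step_size :: real where
  "step_size = min (1 / (2 * C)) (min (1 / (2 * r * K))
     (\<beta> / (4 * (2 * K * C\<^sup>2 + 2 * r * C * K * (K + 1) + 2 * r\<^sup>2 * (K + 1)))))"

lemma step_size_pos: "0 < step_size"
proof -
  have "0 < K * C\<^sup>2" "0 < r * C * K * (K + 1)" "0 < r\<^sup>2 * (K + 1)" "0 < r * K"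
    using C_pos r_pos K_pos by simp_all
  then have "0 < 2 * K * C\<^sup>2 + 2 * r * C * K * (K + 1) + 2 * r\<^sup>2 * (K + 1)" by linarith
  then show ?thesis unfolding step_size_def using C_pos \<beta>_pos r_pos K_pos by simp
qed

text \<open>The left-hand side is the derivative at time \<open>t\<close> of the expectation of \<open>W\<close> when the state has moved in a straight
line from \<open>x\<close> with velocity \<open>v\<close> while the index has switched with probability \<open>p\<close>. At \<open>t = 0\<close> it is the
generator. The deviation for small \<open>t\<close> has two sources, the velocity being evaluated at \<open>x\<close> instead of \<open>y\<close>
and \<open>p\<close> being positive, and both are \<open>O(t) W\<close> uniformly in \<open>x\<close>. They cost a quarter of the
rate \<open>\<beta>\<close>, and comparing \<open>W i y\<close> with the expectation costs another quarter.\<close>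

lemma euler_expected_slope:
  fixes i :: 2
  assumes x: "x \<noteq> 0" and t: "0 \<le> t" "t \<le> step_size"
  defines "v \<equiv> A i *v x" defines "y \<equiv> x + t *\<^sub>R v" defines "p \<equiv> switch_prob t"
  shows "(1 - p) * (G i y \<bullet> v) + p * (G (1 - i) y \<bullet> v) + r * (1 - 2 * p) * (W (1 - i) y - W i y)
     \<le> - (\<beta> / 2) * ((1 - p) * W i y + p * W (1 - i) y)"
proof -
  define c where "c = 2 * K * C\<^sup>2 + 2 * r * C * K * (K + 1) + 2 * r\<^sup>2 * (K + 1)"
  have "0 < K * C\<^sup>2" "0 < r * C * K * (K + 1)" "0 < r\<^sup>2 * (K + 1)"
    using C_pos r_pos K_pos by simp_all
  then have c: "0 < c" unfolding c_def by linarith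
  have t1: "2 * C * t \<le> 1" and t2: "2 * r * K * t \<le> 1" and t3: "4 * c * t \<le> \<beta>"
  proof -
    have "t \<le> 1 / (2 * C)" "t \<le> 1 / (2 * r * K)" "t \<le> \<beta> / (4 * c)"
      using t(2) unfolding step_size_def c_def[symmetric] by simp_all
    then show "2 * C * t \<le> 1" "2 * r * K * t \<le> 1" "4 * c * t \<le> \<beta>"
      using C_pos r_pos K_pos c mult_pos_pos[OF r_pos K_pos] by (simp_all add: pos_le_divide_eq mult.commute[of t] mult.assoc)
  qed
  have y: "norm x \<le> 2 * norm y" "y \<noteq> 0"
    unfolding y_def v_def using euler_segment[OF x t(1) t1] by auto
  have p: "0 \<le> p" "p \<le> r * t" "p \<le> 1" unfolding p_def using switch_prob_bounds[OF t(1)] .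
  have "C * norm x \<le> C * (2 * norm y)" using y(1) C_pos by (intro mult_left_mono) auto
  then have v: "norm v \<le> 2 * C * norm y"
    unfolding v_def using norm_A[of i x] by linarith
  have Wy: "0 < W i y" "0 < W (1 - i) y" "W (1 - i) y \<le> K * W i y" "W i y \<le> K * W (1 - i) y"
    using W_pos[OF y(2)] W_comparable[OF y(2)] by auto
  have Gv: "\<bar>G j y \<bullet> u\<bar> \<le> K * W j y * b" if "norm u \<le> b * norm y" "0 \<le> b" for j u b
  proof -
    have "\<bar>G j y \<bullet> u\<bar> \<le> norm (G j y) * norm u" by (rule Cauchy_Schwarz_ineq2)
    also have "\<dots> \<le> norm (G j y) * (b * norm y)" using that by (intro mult_left_mono) auto
    also have "\<dots> = (norm (G j y) * norm y) * b" by simp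
    also have "\<dots> \<le> (K * W j y) * b" using G_bound[OF y(2), of j] that by (intro mult_right_mono) auto
    finally show ?thesis .
  qed
  have "v - A i *v y = - (t *\<^sub>R (A i *v v))"
    by (simp add: y_def v_def matrix_vector_right_distrib matrix_vector_mult_scaleR)
  then have "norm (v - A i *v y) \<le> t * (C * norm v)"
    using norm_A[of i v] t by (simp add: mult_left_mono)
  also have "\<dots> \<le> t * (C * (2 * C * norm y))" using v C_pos t by (intro mult_left_mono) auto
  finally have "norm (v - A i *v y) \<le> (2 * C\<^sup>2 * t) * norm y" by (simp add: power2_eq_square mult_ac)
  from Gv[OF this, of i] have "\<bar>G i y \<bullet> (v - A i *v y)\<bar> \<le> K * W i y * (2 * C\<^sup>2 * t)" using t by simp
  then have 1: "G i y \<bullet> v \<le> G i y \<bullet> (A i *v y) + K * W i y * (2 * C\<^sup>2 * t)"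
    by (simp add: inner_diff_right)
  have 2: "p * (G (1 - i) y \<bullet> v - G i y \<bullet> v) \<le> (r * t) * (2 * C * K * (K + 1) * W i y)"
  proof -
    have "\<bar>G (1 - i) y \<bullet> v\<bar> \<le> K * W (1 - i) y * (2 * C)" "\<bar>G i y \<bullet> v\<bar> \<le> K * W i y * (2 * C)"
      using Gv[of v "2 * C"] v C_pos by simp_all
    moreover have "K * W (1 - i) y * (2 * C) \<le> K * (K * W i y) * (2 * C)"
      using Wy K_pos C_pos by (intro mult_right_mono mult_left_mono) auto
    moreover have "2 * C * K * (K + 1) * W i y = K * (K * W i y) * (2 * C) + K * W i y * (2 * C)"
      by (simp add: algebra_simps)
    ultimately have "G (1 - i) y \<bullet> v - G i y \<bullet> v \<le> 2 * C * K * (K + 1) * W i y"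
      by linarith
    then have "p * (G (1 - i) y \<bullet> v - G i y \<bullet> v) \<le> p * (2 * C * K * (K + 1) * W i y)"
      using p by (intro mult_left_mono) auto
    also have "\<dots> \<le> (r * t) * (2 * C * K * (K + 1) * W i y)"
      using p Wy K_pos C_pos by (intro mult_right_mono) auto
    finally show ?thesis .
  qed
  have 3: "2 * r * p * (W i y - W (1 - i) y) \<le> (r * t) * (2 * r * (K + 1) * W i y)"
  proof -
    have "2 * r * p * (W i y - W (1 - i) y) \<le> 2 * r * p * ((K + 1) * W i y)"
      using p r_pos Wy K_pos by (intro mult_left_mono) (auto simp: algebra_simps add_increasing)
    also have "\<dots> \<le> 2 * r * (r * t) * ((K + 1) * W i y)"
      using p r_pos Wy K_pos by (intro mult_right_mono mult_left_mono) auto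
    finally show ?thesis by (simp only: mult_ac)
  qed
  have "(1 - p) * (G i y \<bullet> v) + p * (G (1 - i) y \<bullet> v) + r * (1 - 2 * p) * (W (1 - i) y - W i y)
     = G i y \<bullet> v + r * (W (1 - i) y - W i y) + p * (G (1 - i) y \<bullet> v - G i y \<bullet> v)
       + 2 * r * p * (W i y - W (1 - i) y)" by (simp add: algebra_simps)
  also have "\<dots> \<le> - \<beta> * W i y + K * W i y * (2 * C\<^sup>2 * t) + (r * t) * (2 * C * K * (K + 1) * W i y)
       + (r * t) * (2 * r * (K + 1) * W i y)"
    using 1 2 3 generator[OF y(2), of i] by linarith
  also have "\<dots> = (- \<beta> + c * t) * W i y" by (simp add: c_def algebra_simps power2_eq_square)
  also have "\<dots> \<le> (- (3/4) * \<beta>) * W i y" using t3 Wy by (intro mult_right_mono) auto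
  finally have slope: "(1 - p) * (G i y \<bullet> v) + p * (G (1 - i) y \<bullet> v) + r * (1 - 2 * p) * (W (1 - i) y - W i y)
     \<le> - (3/4) * \<beta> * W i y" by simp
  have "p * W (1 - i) y \<le> (r * t) * (K * W i y)"
    using p Wy K_pos t r_pos by (intro mult_mono) auto
  also have "\<dots> = (r * K * t) * W i y" by simp
  also have "\<dots> \<le> (1/2) * W i y" using t2 Wy by (intro mult_right_mono) auto
  finally have "(1 - p) * W i y + p * W (1 - i) y \<le> (3/2) * W i y"
    using mult_nonneg_nonneg[OF p(1), of "W i y"] Wy by (simp add: algebra_simps)
  then have "(\<beta> / 2) * ((1 - p) * W i y + p * W (1 - i) y) \<le> (\<beta> / 2) * ((3/2) * W i y)"
    using \<beta>_pos by (intro mult_left_mono) auto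
  then show ?thesis using slope by simp
qed

lemma euler_step_decrease:
  assumes x: "x \<noteq> 0" and h: "0 \<le> h" "h \<le> step_size"
  shows "(1 - switch_prob h) * W i (x + h *\<^sub>R (A i *v x)) + switch_prob h * W (1 - i) (x + h *\<^sub>R (A i *v x))
     \<le> exp (- (\<beta> / 2) * h) * W i x"
proof -
  define v where "v = A i *v x"
  define y where "y t = x + t *\<^sub>R v" for t
  define S where "S t = (1 - switch_prob t) * W i (y t) + switch_prob t * W (1 - i) (y t)" for t
  define S' where "S' t = (1 - switch_prob t) * (G i (y t) \<bullet> v) + switch_prob t * (G (1 - i) (y t) \<bullet> v)
     + r * (1 - 2 * switch_prob t) * (W (1 - i) (y t) - W i (y t))" for t
  have S': "S' t \<le> - (\<beta> / 2) * S t" if "0 \<le> t" "t \<le> h" for t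
    unfolding S'_def S_def y_def v_def using euler_expected_slope[OF x that(1), of i] that h by simp
  have dS: "(S has_real_derivative S' t) (at t)" if "0 \<le> t" "t \<le> h" for t
  proof -
    have "t \<le> 1 / (2 * C)" using that h unfolding step_size_def by simp
    then have "2 * C * t \<le> 1" using C_pos by (simp add: pos_le_divide_eq mult.commute)
    then have nz: "y t \<noteq> 0" unfolding y_def v_def using euler_segment[OF x that(1)] by auto
    have dW: "((\<lambda>t. W j (y t)) has_real_derivative G j (y t) \<bullet> v) (at t)" for j
    proof -
      have "(y has_derivative (\<lambda>s. s *\<^sub>R v)) (at t)" unfolding y_def
        by (auto intro!: derivative_eq_intros)
      from has_derivative_compose[OF this W_deriv[OF nz]]
      have "((\<lambda>s. W j (y s)) has_derivative (\<lambda>s. (G j (y t) \<bullet> v) * s)) (at t)"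
        by (simp add: mult.commute)
      then show ?thesis by (simp add: has_field_derivative_def)
    qed
    have dp: "(switch_prob has_real_derivative r * (1 - 2 * switch_prob t)) (at t)"
      
    proof -
      have "((\<lambda>t. (1 - exp (- 2 * r * t)) / 2) has_real_derivative r * exp (- 2 * r * t)) (at t)"
        by (auto intro!: derivative_eq_intros)
      moreover have "exp (- 2 * r * t) = 1 - 2 * switch_prob t"
        by (simp add: switch_prob_def diff_divide_distrib)
      ultimately show ?thesis unfolding switch_prob_def[abs_def] by simp
    qed
    show ?thesis unfolding S_def S'_def
      by (rule DERIV_cong[OF DERIV_add[OF DERIV_mult[OF DERIV_diff[OF DERIV_const dp] dW] DERIV_mult[OF dp dW]]])
        (simp add: algebra_simps)
  qed
  define f where "f t = exp (\<beta> / 2 * t) * S t" for t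
  have "f h \<le> f 0"
  proof (rule DERIV_nonpos_imp_nonincreasing[OF h(1)])
    fix t assume t: "0 \<le> t" "t \<le> h"
    have e: "((\<lambda>t. exp (\<beta> / 2 * t)) has_real_derivative exp (\<beta> / 2 * t) * (\<beta> / 2)) (at t)"
      by (auto intro!: derivative_eq_intros)
    have "(f has_real_derivative exp (\<beta> / 2 * t) * (\<beta> / 2 * S t + S' t)) (at t)"
      unfolding f_def by (rule DERIV_cong[OF DERIV_mult[OF e dS[OF t]]]) (simp add: algebra_simps)
    moreover have "exp (\<beta> / 2 * t) * (\<beta> / 2 * S t + S' t) \<le> 0"
      using S'[OF t] by (intro mult_nonneg_nonpos) auto
    ultimately show "\<exists>d. (f has_real_derivative d) (at t) \<and> d \<le> 0" by blast
  qed
  then have "S h \<le> exp (- (\<beta> / 2) * h) * S 0"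
    by (simp add: f_def exp_minus field_simps)
  then show ?thesis by (simp add: S_def y_def v_def switch_prob_def)
qed

end

section \<open>Conditional probabilities given the past\<close>

lemma measurable_euler:
  fixes J :: "real \<Rightarrow> 'w \<Rightarrow> 'e::finite"
  assumes [measurable]: "Z \<in> borel_measurable N"
    and J: "\<And>j. j < k \<Longrightarrow> J (real j * h) \<in> N \<rightarrow>\<^sub>M count_space UNIV"
  shows "(\<lambda>w. euler A h (\<lambda>t. J t w) (Z w) k) \<in> borel_measurable N"
  using J
proof (induction k)
  case 0
  show ?case by simp
next
  case (Suc k)
  then have [measurable]: "(\<lambda>w. euler A h (\<lambda>t. J t w) (Z w) k) \<in> borel_measurable N" by simp
  have [measurable]: "(\<lambda>w. A i *v euler A h (\<lambda>t. J t w) (Z w) k) \<in> borel_measurable N" for i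
    by (rule measurable_compose[where N=borel]) 
       (auto intro!: borel_measurable_continuous_onI linear_continuous_on matrix_vector_mul_bounded_linear)
  have [measurable]: "(\<lambda>w. A (J (real k * h) w) *v euler A h (\<lambda>t. J t w) (Z w) k) \<in> borel_measurable N"
    by (rule measurable_compose_countable'[where I=UNIV and g="J (real k * h)"]) (use Suc.prems in auto)
  show ?case by simp
qed

text \<open>The defining property of conditional expectation for nonnegative integrands, which need not be integrable.\<close>

lemma nn_integral_conditional_probability:
  assumes "prob_space M" and sub: "subalgebra M F" and E: "E \<in> sets M"
    and f: "f \<in> borel_measurable F"
    and q: "AE w in M. real_cond_exp M F (indicator E) w = q w"
  shows "(\<integral>\<^sup>+w. f w * indicator E w \<partial>M) = (\<integral>\<^sup>+w. f w * ennreal (q w) \<partial>M)"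
proof -
  interpret prob_space M by fact
  interpret finite_measure_subalgebra M F by standard (rule sub)
  let ?c = "nn_cond_exp M F (\<lambda>w. ennreal (indicator E w))"
  note [measurable] = E
  have "AE w in M. ?c w \<le> nn_cond_exp M F (\<lambda>w. 1) w"
    by (rule nn_cond_exp_mono) (auto simp: indicator_def)
  moreover have "AE w in M. 1 = nn_cond_exp M F (\<lambda>w. 1) w" by (rule nn_cond_exp_F_meas) simp
  moreover have "AE w in M. 0 = nn_cond_exp M F (\<lambda>w. 0) w" by (rule nn_cond_exp_F_meas) simp
  moreover have "(\<lambda>w. ennreal (- indicator E w)) = (\<lambda>w. 0)" by (auto simp: indicator_def ennreal_neg)
  \<comment> \<open>The nonnegative conditional expectation is at most 1, so passing to real numbers loses nothing.\<close>
  moreover have "AE w in M. ?c w = ennreal (q w)"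
    if "(\<lambda>w. ennreal (- indicator E w)) = (\<lambda>w. 0)" "AE w in M. ?c w \<le> nn_cond_exp M F (\<lambda>w. 1) w"
      "AE w in M. 1 = nn_cond_exp M F (\<lambda>w. 1) w" "AE w in M. 0 = nn_cond_exp M F (\<lambda>w. 0) w"
    using that(2-4) q unfolding real_cond_exp_def that(1)
  proof (eventually_elim)
    case (elim w)
    then have "?c w < top" by (metis ennreal_one_less_top order_le_less_trans)
    then show ?case using elim by (metis diff_zero enn2real_0 ennreal_enn2real)
  qed
  ultimately have c: "AE w in M. ?c w = ennreal (q w)" by blast
  have "(\<integral>\<^sup>+w. f w * indicator E w \<partial>M) = (\<integral>\<^sup>+w. f w * ennreal (indicator E w) \<partial>M)"
    by (simp add: ennreal_indicator)
  also have "\<dots> = (\<integral>\<^sup>+w. f w * ?c w \<partial>M)"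
    by (rule nn_cond_exp_intg[symmetric]) (use f in auto)
  also have "\<dots> = (\<integral>\<^sup>+w. f w * ennreal (q w) \<partial>M)"
    by (rule nn_integral_cong_AE) (use c in eventually_elim, simp)
  finally show ?thesis .
qed

lemma sets_past:
  "sets (past M Z J s) = sigma_sets (space M) ({Z -` B \<inter> space M | B. B \<in> sets borel} \<union>
      {J u -` S \<inter> space M | u S. 0 \<le> u \<and> u \<le> s})"
  "space (past M Z J s) = space M"
proof -
  have "{Z -` B \<inter> space M | B. B \<in> sets borel} \<union> {J u -` S \<inter> space M | u S. 0 \<le> u \<and> u \<le> s}
    \<subseteq> Pow (space M)" by blast
  then show "sets (past M Z J s) = sigma_sets (space M) ({Z -` B \<inter> space M | B. B \<in> sets borel} \<union>
      {J u -` S \<inter> space M | u S. 0 \<le> u \<and> u \<le> s})" "space (past M Z J s) = space M"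
    unfolding past_def by (rule sets_measure_of, rule space_measure_of)
qed

lemma subalgebra_past:
  assumes Z: "Z \<in> borel_measurable M" and J: "\<And>u. 0 \<le> u \<Longrightarrow> J u \<in> M \<rightarrow>\<^sub>M count_space UNIV"
  shows "subalgebra M (past M Z J s)"
proof -
  have "{Z -` B \<inter> space M | B. B \<in> sets borel} \<union> {J u -` S \<inter> space M | u S. 0 \<le> u \<and> u \<le> s}
    \<subseteq> sets M"
  proof (intro Un_least subsetI)
    fix E assume "E \<in> {Z -` B \<inter> space M | B. B \<in> sets borel}"
    then show "E \<in> sets M" using measurable_sets[OF Z] by blast
  next
    fix E assume "E \<in> {J u -` S \<inter> space M | u S. 0 \<le> u \<and> u \<le> s}"
    then obtain u S where "E = J u -` S \<inter> space M" "0 \<le> u" by blast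
    then show "E \<in> sets M" using measurable_sets[OF J, of u S] by simp
  qed
  then show ?thesis unfolding subalgebra_def sets_past by (simp add: sets.sigma_sets_subset)
qed

lemma measurable_past:
  shows "Z \<in> borel_measurable (past M Z J s)"
    and "\<lbrakk>0 \<le> u; u \<le> s\<rbrakk> \<Longrightarrow> J u \<in> past M Z J s \<rightarrow>\<^sub>M count_space UNIV"
proof -
  show "Z \<in> borel_measurable (past M Z J s)"
    by (rule measurableI) (auto simp: sets_past intro!: sigma_sets.Basic)
  show "J u \<in> past M Z J s \<rightarrow>\<^sub>M count_space UNIV" if "0 \<le> u" "u \<le> s"
  proof (rule measurableI)
    show "J u -` S \<inter> space (past M Z J s) \<in> sets (past M Z J s)" for S
      unfolding sets_past by (rule sigma_sets.Basic) (use that in blast)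
  qed simp
qed

section \<open>Lyapunov functions along the switched process\<close>

context switched_lyapunov
begin

text \<open>The spacing \<open>1 / (4 C)\<close> of the grid keeps a solution within a factor 2 of its value at the preceding grid
point, in both directions. So a solution that starts off the origin never reaches it, and its behaviour at infinity
can be read off on the grid.\<close>

lemma solution_on_grid:
  assumes sol: "switched_solution A p x" and x0: "x 0 \<noteq> 0"
  defines "\<delta> \<equiv> 1 / (4 * C)"
  shows "\<And>m t. \<lbrakk>real m * \<delta> \<le> t; t \<le> real m * \<delta> + \<delta>\<rbrakk> \<Longrightarrow>
      norm (x (real m * \<delta>)) \<le> 2 * norm (x t) \<and> norm (x t) \<le> 2 * norm (x (real m * \<delta>))"
    and "\<And>m. x (real m * \<delta>) \<noteq> 0"
proof -
  have \<delta>: "0 < \<delta>" using C_pos by (simp add: \<delta>_def)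
  show near: "norm (x (real m * \<delta>)) \<le> 2 * norm (x t) \<and> norm (x t) \<le> 2 * norm (x (real m * \<delta>))"
    if t: "real m * \<delta> \<le> t" "t \<le> real m * \<delta> + \<delta>" for m t
  proof -
    define s where "s = real m * \<delta>"
    have "2 * C * (t - s) \<le> 2 * C * \<delta>" using t C_pos by (intro mult_left_mono) (auto simp: s_def)
    also have "\<dots> = 1/2" using C_pos by (simp add: \<delta>_def)
    finally have half: "2 * C * (t - s) \<le> 1/2" .
    have "norm (x t - x s) \<le> 2 * C * (t - s) * norm (x s)"
      by (rule switched_solution_increment[OF sol norm_A]) (use t half \<delta> C_pos in \<open>auto simp: s_def\<close>)
    also have "\<dots> \<le> (1/2) * norm (x s)" using half by (rule mult_right_mono) simp
    finally have "norm (x t - x s) \<le> (1/2) * norm (x s)" .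
    then show ?thesis unfolding s_def[symmetric]
      using norm_triangle_ineq2[of "x t" "x s"] norm_triangle_ineq3[of "x t" "x s"] norm_ge_zero[of "x s"]
      by linarith
  qed
  show "x (real m * \<delta>) \<noteq> 0" for m
  proof (induction m)
    case (Suc m)
    have "norm (x (real m * \<delta>)) \<le> 2 * norm (x (real (Suc m) * \<delta>))"
      using near[of m "real (Suc m) * \<delta>"] \<delta> by (simp add: algebra_simps)
    then show ?case using Suc by auto
  qed (use x0 in simp)
qed

lemma euler_nonzero:
  assumes "z \<noteq> 0" and "0 \<le> h" "h \<le> step_size"
  shows "euler A h p z k \<noteq> 0"
proof (induction k)
  case (Suc k)
  have "h \<le> 1 / (2 * C)" using assms unfolding step_size_def by simp
  then have "2 * C * h \<le> 1" using C_pos by (simp add: pos_le_divide_eq mult.commute)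
  then show ?case using euler_segment[OF Suc assms(2)] by simp
qed (use assms in simp)

text \<open>Given the past up to \<open>k h\<close>, the next Euler point is already determined and only the next state of the index is random.
The conditional expectation of \<open>W\<close> is then exactly the two-term sum in the one-step estimate. Dividing by
the initial value of \<open>W\<close>, which belongs to the past at every time, gives finite expectations without
any moment assumption on the initial value.\<close>

lemma expected_euler_decrease:
  assumes ps: "prob_space M" and jm: "jump_markov_process M Z (r *\<^sub>R switch_matrix) J"
    and nz: "AE w in M. Z w \<noteq> 0" and h: "0 \<le> h" "h \<le> step_size"
  shows "(\<integral>\<^sup>+w. ennreal (W (J (real k * h) w) (euler A h (\<lambda>t. J t w) (Z w) k) / W (J 0 w) (Z w)) \<partial>M)
    \<le> ennreal (exp (- (\<beta> / 2) * h * real k))"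
proof (induction k)
  case 0
  interpret prob_space M by fact
  have "(\<integral>\<^sup>+w. ennreal (W (J 0 w) (Z w) / W (J 0 w) (Z w)) \<partial>M) \<le> (\<integral>\<^sup>+w. 1 \<partial>M)"
    by (rule nn_integral_mono) (simp add: divide_self_if)
  then show ?case by (simp add: emeasure_space_1)
next
  case (Suc k)
  interpret prob_space M by fact
  define s where "s = real k * h"
  define s' where "s' = real (Suc k) * h"
  have s': "s' = s + h" by (simp add: s_def s'_def algebra_simps)
  have s0: "0 \<le> s" using h by (simp add: s_def)
  define F where "F = past M Z J s"
  define y where "y k w = euler A h (\<lambda>t. J t w) (Z w) k" for k w
  define w0 where "w0 w = W (J 0 w) (Z w)" for w
  have Z: "Z \<in> borel_measurable M" and J: "\<And>u. 0 \<le> u \<Longrightarrow> J u \<in> M \<rightarrow>\<^sub>M count_space UNIV"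
    using jm by (auto simp: jump_markov_process_def)
  have sub: "subalgebra M F" unfolding F_def by (rule subalgebra_past[OF Z J])
  have ZF [measurable]: "Z \<in> borel_measurable F" unfolding F_def by (rule measurable_past)
  have JF: "J u \<in> F \<rightarrow>\<^sub>M count_space UNIV" if "0 \<le> u" "u \<le> s" for u
    unfolding F_def by (rule measurable_past(2)[OF that])
  have [measurable]: "y (Suc k) \<in> borel_measurable F"
    unfolding y_def
  proof (rule measurable_euler[OF ZF JF])
    show "real j * h \<le> s" if "j < Suc k" for j
      unfolding s_def using that h by (intro mult_right_mono) auto
  qed (use h in auto)
  have [measurable]: "w0 \<in> borel_measurable F"
    unfolding w0_def
    by (rule measurable_compose_countable'[where I=UNIV and g="J 0"]) (use JF[of 0] s0 in auto)
  define f where "f j w = ennreal (W j (y (Suc k) w) / w0 w)" for j w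
  have f [measurable]: "f j \<in> borel_measurable F" for j unfolding f_def by measurable
  have fM [measurable]: "f j \<in> borel_measurable M" for j by (rule measurable_from_subalg[OF sub f])
  define E where "E j = {w \<in> space M. J s' w = j}" for j
  have [measurable]: "J s' \<in> M \<rightarrow>\<^sub>M count_space UNIV" "J s \<in> M \<rightarrow>\<^sub>M count_space UNIV"
    using J s0 s' h by auto
  have E [measurable]: "E j \<in> sets M" for j unfolding E_def by measurable
  define q where "q w j = matrix_exp (h *\<^sub>R r *\<^sub>R switch_matrix) $ J s w $ j" for w j
  have q: "q w j = (if J s w = j then 1 - switch_prob h else switch_prob h)" for w j
    using matrix_exp_switch[of "h * r" "J s w" j] by (simp add: q_def switch_prob_def mult_ac)
  have cond: "AE w in M. real_cond_exp M F (indicator (E j)) w = q w j" for j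
    using jm s0 h unfolding jump_markov_process_def F_def E_def q_def s' by blast
  have split: "ennreal (W (J s' w) (y (Suc k) w) / w0 w) = (\<Sum>j\<in>UNIV. f j w * indicator (E j) w)"
    if "w \<in> space M" for w
  proof -
    have "f j w * indicator (E j) w = (if j = J s' w then f j w else 0)" for j
      using that by (auto simp: E_def indicator_def)
    then show ?thesis by (simp add: f_def)
  qed
  have "(\<integral>\<^sup>+w. ennreal (W (J s' w) (y (Suc k) w) / w0 w) \<partial>M)
      = (\<integral>\<^sup>+w. (\<Sum>j\<in>UNIV. f j w * indicator (E j) w) \<partial>M)"
    by (rule nn_integral_cong) (rule split)
  also have "\<dots> = (\<Sum>j\<in>UNIV. \<integral>\<^sup>+w. f j w * indicator (E j) w \<partial>M)"
    by (rule nn_integral_sum) measurable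
  also have "\<dots> = (\<Sum>j\<in>UNIV. \<integral>\<^sup>+w. f j w * ennreal (q w j) \<partial>M)"
    by (intro sum.cong refl nn_integral_conditional_probability[OF ps sub E f cond])
  also have "\<dots> = (\<integral>\<^sup>+w. (\<Sum>j\<in>UNIV. f j w * ennreal (q w j)) \<partial>M)"
    unfolding q by (rule nn_integral_sum[symmetric]) measurable
  also have "\<dots> \<le> (\<integral>\<^sup>+w. ennreal (exp (- (\<beta> / 2) * h)) * ennreal (W (J s w) (y k w) / w0 w) \<partial>M)"
  proof (rule nn_integral_mono_AE)
    show "AE w in M. (\<Sum>j\<in>UNIV. f j w * ennreal (q w j))
       \<le> ennreal (exp (- (\<beta> / 2) * h)) * ennreal (W (J s w) (y k w) / w0 w)"
      using nz
    proof eventually_elim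
      case (elim w)
      let ?i = "J s w" and ?p = "switch_prob h"
      have yk: "y k w \<noteq> 0" and yk': "y (Suc k) w \<noteq> 0"
        unfolding y_def by (rule euler_nonzero[OF elim h])+
      have ySuc: "y (Suc k) w = y k w + h *\<^sub>R (A ?i *v y k w)" by (simp add: y_def s_def)
      have w0: "0 < w0 w" unfolding w0_def by (rule W_pos[OF elim])
      have p: "0 \<le> ?p" "?p \<le> 1" using switch_prob_bounds[OF h(1)] by auto
      have "?i \<noteq> 1 - ?i" using two_cases[of ?i] by auto
      then have "(\<Sum>j\<in>UNIV. f j w * ennreal (q w j)) = f ?i w * ennreal (1 - ?p) + f (1 - ?i) w * ennreal ?p"
        by (simp add: sum_over_2[where i="?i"] q)
      also have "\<dots> = ennreal (W ?i (y (Suc k) w) / w0 w * (1 - ?p) + W (1 - ?i) (y (Suc k) w) / w0 w * ?p)"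
        unfolding f_def using W_pos[OF yk'] w0 p
        by (simp add: ennreal_mult[symmetric] ennreal_plus[symmetric] less_imp_le del: ennreal_plus)
      also have "\<dots> = ennreal (((1 - ?p) * W ?i (y (Suc k) w) + ?p * W (1 - ?i) (y (Suc k) w)) / w0 w)"
        by (simp add: add_divide_distrib mult_ac)
      also have "\<dots> \<le> ennreal ((exp (- (\<beta> / 2) * h) * W ?i (y k w)) / w0 w)"
        unfolding ySuc using euler_step_decrease[OF yk h, of ?i] w0
        by (intro ennreal_leI divide_right_mono) auto
      also have "\<dots> = ennreal (exp (- (\<beta> / 2) * h)) * ennreal (W ?i (y k w) / w0 w)"
        using W_pos[OF yk] w0 by (simp add: ennreal_mult[symmetric] less_imp_le)
      finally show ?case .
    qed
  qed
  also have "\<dots> = ennreal (exp (- (\<beta> / 2) * h)) * (\<integral>\<^sup>+w. ennreal (W (J s w) (y k w) / w0 w) \<partial>M)"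
  proof (rule nn_integral_cmult)
    have [measurable]: "y k \<in> borel_measurable F"
      unfolding y_def
    proof (rule measurable_euler[OF ZF JF])
      show "real j * h \<le> s" if "j < k" for j
        unfolding s_def using that h by (intro mult_right_mono) auto
    qed (use h in auto)
    have "(\<lambda>w. W (J s w) (y k w) / w0 w) \<in> borel_measurable F"
      by (rule measurable_compose_countable'[where I=UNIV and g="J s"]) (use JF[of s] s0 in auto)
    then have "(\<lambda>w. W (J s w) (y k w) / w0 w) \<in> borel_measurable M"
      by (rule measurable_from_subalg[OF sub])
    then show "(\<lambda>w. ennreal (W (J s w) (y k w) / w0 w)) \<in> borel_measurable M" by measurable
  qed
  also have "\<dots> \<le> ennreal (exp (- (\<beta> / 2) * h)) * ennreal (exp (- (\<beta> / 2) * h * real k))"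
    using Suc unfolding s_def y_def w0_def by (rule mult_left_mono) simp
  also have "\<dots> = ennreal (exp (- (\<beta> / 2) * h * real (Suc k)))"
    by (simp add: ennreal_mult[symmetric] exp_add[symmetric] algebra_simps)
  finally show ?case unfolding y_def w0_def s'_def .
qed

text \<open>Fatou's lemma carries the Euler estimate over to the process as \<open>h \<rightarrow> 0\<close>. The values of the process itself are
not known to be measurable, so they are represented by the measurable lower limit \<open>g\<close>, to which they are
almost surely equal.\<close>

lemma expected_value_along_process:
  assumes ps: "prob_space M" and jm: "jump_markov_process M (X 0) (r *\<^sub>R switch_matrix) J"
    and sol: "AE w in M. switched_solution A (\<lambda>t. J t w) (\<lambda>t. X t w)"
    and nz: "AE w in M. X 0 w \<noteq> 0"
    and T: "T = real m * (1 / (4 * C))"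
  obtains g where "g \<in> borel_measurable M" "(\<integral>\<^sup>+w. g w \<partial>M) \<le> ennreal (exp (- (\<beta> / 2) * T))"
    "AE w in M. g w = ennreal (W (J T w) (X T w) / W (J 0 w) (X 0 w))"
proof -
  define \<delta> where "\<delta> = 1 / (4 * C)"
  have \<delta>: "0 < \<delta>" using C_pos by (simp add: \<delta>_def)
  obtain N where N: "\<delta> / step_size < real N" using reals_Archimedean2 by blast
  define h where "h n = \<delta> / real (n + N + 1)" for n
  define k where "k n = m * (n + N + 1)" for n
  have kh: "real (k n) * h n = T" for n
  proof -
    have "real m * q * (d / q) = real m * d" if "q \<noteq> 0" for q d :: real using that by simp
    from this[of "real (n + N + 1)" \<delta>] show ?thesis
      unfolding k_def h_def T \<delta>_def of_nat_mult by simp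
  qed
  have h_pos: "0 < h n" for n using \<delta> by (simp add: h_def)
  have h_le: "h n \<le> step_size" for n
  proof -
    have "\<delta> < real N * step_size" using N step_size_pos by (simp add: pos_divide_less_eq)
    also have "\<dots> \<le> real (n + N + 1) * step_size" using step_size_pos by (intro mult_right_mono) auto
    finally show ?thesis by (simp add: h_def pos_divide_le_eq mult.commute)
  qed
  have h_lim: "h \<longlonglongrightarrow> 0"
    using LIMSEQ_ignore_initial_segment[OF lim_const_over_n, of \<delta> "N + 1"]
    unfolding h_def[abs_def] add.assoc .
  have T0: "0 \<le> T" using C_pos by (simp add: T)
  define V where "V n w = W (J T w) (euler A (h n) (\<lambda>t. J t w) (X 0 w) (k n)) / W (J 0 w) (X 0 w)" for n w
  have Z [measurable]: "X 0 \<in> borel_measurable M" and J: "\<And>u. 0 \<le> u \<Longrightarrow> J u \<in> M \<rightarrow>\<^sub>M count_space UNIV"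
    and jp: "AE w in M. jump_path (\<lambda>t. J t w)"
    using jm by (auto simp: jump_markov_process_def)
  have [measurable]: "V n \<in> borel_measurable M" for n
  proof -
    have e [measurable]: "(\<lambda>w. euler A (h n) (\<lambda>t. J t w) (X 0 w) (k n)) \<in> borel_measurable M"
      by (rule measurable_euler[OF Z J]) (use h_pos[of n] in auto)
    have [measurable]: "(\<lambda>w. W (J T w) (euler A (h n) (\<lambda>t. J t w) (X 0 w) (k n))) \<in> borel_measurable M"
      by (rule measurable_compose_countable'[where I=UNIV and g="J T"]) (use J[OF T0] in auto)
    have [measurable]: "(\<lambda>w. W (J 0 w) (X 0 w)) \<in> borel_measurable M"
      by (rule measurable_compose_countable'[where I=UNIV and g="J 0"]) (use J[of 0] in auto)
    show ?thesis unfolding V_def by measurable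
  qed
  define g where "g w = liminf (\<lambda>n. ennreal (V n w))" for w
  show ?thesis
  proof (rule that)
    show "g \<in> borel_measurable M" unfolding g_def by measurable
    have "(\<integral>\<^sup>+w. g w \<partial>M) \<le> liminf (\<lambda>n. \<integral>\<^sup>+w. ennreal (V n w) \<partial>M)"
      unfolding g_def by (rule nn_integral_liminf) measurable
    also have "\<dots> \<le> liminf (\<lambda>n::nat. ennreal (exp (- (\<beta> / 2) * T)))"
    proof (rule Liminf_mono, rule always_eventually, rule allI)
      fix n
      show "(\<integral>\<^sup>+w. ennreal (V n w) \<partial>M) \<le> ennreal (exp (- (\<beta> / 2) * T))"
      proof -
        have "- (\<beta> / 2) * h n * real (k n) = - (\<beta> / 2) * T"
          unfolding kh[of n, symmetric] by (simp only: mult_ac)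
        then show ?thesis
          using expected_euler_decrease[OF ps jm nz less_imp_le[OF h_pos] h_le, of "k n" n]
          unfolding V_def kh by (simp only:)
      qed
    qed
    finally show "(\<integral>\<^sup>+w. g w \<partial>M) \<le> ennreal (exp (- (\<beta> / 2) * T))"
      by (simp add: Liminf_const)
    show "AE w in M. g w = ennreal (W (J T w) (X T w) / W (J 0 w) (X 0 w))"
      using sol nz jp
    proof eventually_elim
      case (elim w)
      have "X T w \<noteq> 0" using solution_on_grid(2)[OF elim(1,2), of m] T by simp
      have "(\<lambda>n. euler A (h n) (\<lambda>t. J t w) (X 0 w) (k n)) \<longlonglongrightarrow> X T w"
        by (rule euler_convergence[OF elim(1,3) norm_A]) (use C_pos h_pos h_lim kh in auto)
      moreover have "isCont (W (J T w)) (X T w)"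
        using W_deriv[OF \<open>X T w \<noteq> 0\<close>] has_derivative_continuous by blast
      ultimately have "(\<lambda>n. V n w) \<longlonglongrightarrow> W (J T w) (X T w) / W (J 0 w) (X 0 w)"
        unfolding V_def using W_pos[OF elim(2), of "J 0 w"]
        by (intro tendsto_divide isCont_tendsto_compose[of _ "W (J T w)"] tendsto_const) auto
      then show ?case unfolding g_def
        by (intro lim_imp_Liminf tendsto_ennrealI) auto
    qed
  qed
qed

text \<open>The expectations on the grid decay geometrically, so their sum is finite, and a series of nonnegative random
variables with finite expectation converges almost surely.\<close>

lemma lyapunov_function_tendsto_0:
  assumes ps: "prob_space M" and jm: "jump_markov_process M (X 0) (r *\<^sub>R switch_matrix) J"
    and sol: "AE w in M. switched_solution A (\<lambda>t. J t w) (\<lambda>t. X t w)"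
    and nz: "AE w in M. X 0 w \<noteq> 0"
  defines "\<delta> \<equiv> 1 / (4 * C)"
  shows "AE w in M. (\<lambda>m. W (J (real m * \<delta>) w) (X (real m * \<delta>) w)) \<longlonglongrightarrow> 0"
proof -
  have \<delta>: "0 < \<delta>" using C_pos by (simp add: \<delta>_def)
  define V where "V m w = W (J (real m * \<delta>) w) (X (real m * \<delta>) w) / W (J 0 w) (X 0 w)" for m w
  define b where "b = exp (- (\<beta> / 2) * \<delta>)"
  have b: "0 < b" "b < 1" using \<beta>_pos \<delta> by (auto simp: b_def)
  have "\<exists>g. g \<in> borel_measurable M \<and> (\<integral>\<^sup>+w. g w \<partial>M) \<le> ennreal (b ^ m) \<and> (AE w in M. g w = ennreal (V m w))" for m
  proof -
    have "b ^ m = exp (- (\<beta> / 2) * (real m * \<delta>))"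
      unfolding b_def exp_of_nat_mult[symmetric] by (simp add: mult_ac)
    moreover obtain g where "g \<in> borel_measurable M"
      "(\<integral>\<^sup>+w. g w \<partial>M) \<le> ennreal (exp (- (\<beta> / 2) * (real m * \<delta>)))"
      "AE w in M. g w = ennreal (V m w)"
      unfolding V_def
      by (rule expected_value_along_process[OF ps jm sol nz, of "real m * \<delta>" m]) (simp_all add: \<delta>_def)
    ultimately show ?thesis by auto
  qed
  then obtain g where g [measurable]: "\<And>m. g m \<in> borel_measurable M"
    and int: "\<And>m. (\<integral>\<^sup>+w. g m w \<partial>M) \<le> ennreal (b ^ m)"
    and eq: "\<And>m. AE w in M. g m w = ennreal (V m w)" by metis
  have "(\<integral>\<^sup>+w. (\<Sum>m. g m w) \<partial>M) = (\<Sum>m. \<integral>\<^sup>+w. g m w \<partial>M)"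
    by (rule nn_integral_suminf) measurable
  also have "\<dots> \<le> (\<Sum>m. ennreal (b ^ m))" by (intro suminf_le int) auto
  also have "\<dots> = ennreal (\<Sum>m. b ^ m)"
    using b by (intro suminf_ennreal2 summable_geometric) auto
  finally have "(\<integral>\<^sup>+w. (\<Sum>m. g m w) \<partial>M) \<noteq> \<infinity>" by (auto simp: top_unique)
  then have fin: "AE w in M. (\<Sum>m. g m w) \<noteq> \<infinity>"
    by (intro nn_integral_PInf_AE) measurable
  have "AE w in M. \<forall>m. g m w = ennreal (V m w)" using eq by (simp add: AE_all_countable)
  with fin sol nz show ?thesis
  proof eventually_elim
    case (elim w)
    have w0: "0 < W (J 0 w) (X 0 w)" by (rule W_pos[OF elim(3)])
    have V: "0 \<le> V m w" for m unfolding V_def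
      using W_pos[OF solution_on_grid(2)[OF elim(2,3), of m]] w0 by (simp add: \<delta>_def less_imp_le)
    have "(\<Sum>m. ennreal (V m w)) \<noteq> top" using elim(1,4) by simp
    then have "summable (\<lambda>m. V m w)" by (rule summable_suminf_not_top[OF V])
    then have "(\<lambda>m. V m w * W (J 0 w) (X 0 w)) \<longlonglongrightarrow> 0 * W (J 0 w) (X 0 w)"
      by (intro tendsto_mult_right summable_LIMSEQ_zero)
    then show ?case using w0 by (simp add: V_def)
  qed
qed

lemma filterlim_grid_index: "filterlim (\<lambda>t. nat \<lfloor>t * (4 * C)\<rfloor>) sequentially at_top"
proof -
  have "filterlim (\<lambda>t. t * (4 * C)) at_top at_top"
    using C_pos by (intro filterlim_at_top_mult_tendsto_pos[OF tendsto_const _ filterlim_ident]) auto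
  then show ?thesis
    by (intro filterlim_compose[OF filterlim_nat_sequentially] filterlim_compose[OF filterlim_floor_sequentially])
qed

lemma solution_grid_index:
  assumes sol: "switched_solution A p x" and x0: "x 0 \<noteq> 0" and "0 \<le> t"
  defines "m \<equiv> nat \<lfloor>t * (4 * C)\<rfloor>"
  shows "norm (x (real m * (1 / (4 * C)))) \<le> 2 * norm (x t)" "norm (x t) \<le> 2 * norm (x (real m * (1 / (4 * C))))"
proof -
  have "0 \<le> t * (4 * C)" using C_pos \<open>0 \<le> t\<close> by simp
  then have "real m \<le> t * (4 * C)" "t * (4 * C) \<le> real m + 1"
    unfolding m_def by linarith+
  then have "real m * (1 / (4 * C)) \<le> t" "t \<le> real m * (1 / (4 * C)) + 1 / (4 * C)"
    using C_pos by (simp_all add: field_simps)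
  then show "norm (x (real m * (1 / (4 * C)))) \<le> 2 * norm (x t)" "norm (x t) \<le> 2 * norm (x (real m * (1 / (4 * C))))"
    using solution_on_grid(1)[OF sol x0] by blast+
qed

theorem norm_tendsto_0:
  assumes ps: "prob_space M" and jm: "jump_markov_process M (X 0) (r *\<^sub>R switch_matrix) J"
    and sol: "AE w in M. switched_solution A (\<lambda>t. J t w) (\<lambda>t. X t w)"
    and nz: "AE w in M. X 0 w \<noteq> 0"
    and lower: "\<And>i x. x \<noteq> 0 \<Longrightarrow> (norm x)\<^sup>2 \<le> W i x"
  shows "AE w in M. ((\<lambda>t. norm (X t w)) \<longlongrightarrow> 0) at_top"
  using lyapunov_function_tendsto_0[OF ps jm sol nz] sol nz
proof eventually_elim
  case (elim w)
  define x where "x m = X (real m * (1 / (4 * C))) w" for m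
  have le: "(norm (x m))\<^sup>2 \<le> W (J (real m * (1 / (4 * C))) w) (x m)" for m
    unfolding x_def by (rule lower) (rule solution_on_grid(2)[OF elim(2,3)])
  have "(\<lambda>m. (norm (x m))\<^sup>2) \<longlonglongrightarrow> 0"
    by (rule tendsto_sandwich[OF _ _ tendsto_const elim(1)]) (use le in \<open>auto simp: x_def\<close>)
  then have "(\<lambda>m. sqrt ((norm (x m))\<^sup>2)) \<longlonglongrightarrow> sqrt 0" by (rule tendsto_real_sqrt)
  then have "(\<lambda>m. 2 * norm (x m)) \<longlonglongrightarrow> 2 * 0" by (intro tendsto_mult_left) simp
  then have lim: "((\<lambda>t. 2 * norm (x (nat \<lfloor>t * (4 * C)\<rfloor>))) \<longlongrightarrow> 0) at_top"
    by (intro filterlim_compose[OF _ filterlim_grid_index]) simp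
  show ?case
  proof (rule Lim_null_comparison[OF _ lim])
    show "\<forall>\<^sub>F t in at_top. norm (norm (X t w)) \<le> 2 * norm (x (nat \<lfloor>t * (4 * C)\<rfloor>))"
      using eventually_ge_at_top[of 0]
      by eventually_elim (use solution_grid_index(2)[OF elim(2,3)] in \<open>simp add: x_def mult.commute[of _ 2]\<close>)
  qed
qed

theorem norm_tendsto_at_top:
  assumes ps: "prob_space M" and jm: "jump_markov_process M (X 0) (r *\<^sub>R switch_matrix) J"
    and sol: "AE w in M. switched_solution A (\<lambda>t. J t w) (\<lambda>t. X t w)"
    and nz: "AE w in M. X 0 w \<noteq> 0"
    and p: "0 < p" and lower: "\<And>i x. x \<noteq> 0 \<Longrightarrow> norm x powr - p \<le> c * W i x"
  shows "AE w in M. filterlim (\<lambda>t. norm (X t w)) at_top at_top"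
  using lyapunov_function_tendsto_0[OF ps jm sol nz] sol nz
proof eventually_elim
  case (elim w)
  define x where "x m = X (real m * (1 / (4 * C))) w" for m
  have nzx: "x m \<noteq> 0" for m unfolding x_def by (rule solution_on_grid(2)[OF elim(2,3)])
  have lim0: "(\<lambda>m. c * W (J (real m * (1 / (4 * C))) w) (x m)) \<longlonglongrightarrow> 0"
    using tendsto_mult_left[OF elim(1), of c] by (simp add: x_def)
  have "(\<lambda>m. norm (x m) powr - p) \<longlonglongrightarrow> 0"
  proof (rule tendsto_sandwich[OF _ _ tendsto_const lim0])
    show "\<forall>\<^sub>F m in sequentially. norm (x m) powr - p \<le> c * W (J (real m * (1 / (4 * C))) w) (x m)"
      by (rule always_eventually, rule allI, rule lower[OF nzx])
  qed simp
  then have "filterlim (\<lambda>m. norm (x m) powr - p) (at_right 0) sequentially"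
    by (intro tendsto_imp_filterlim_at_right) (use nzx in auto)
  then have "filterlim (\<lambda>m. inverse (norm (x m) powr - p)) at_top sequentially"
    by (rule filterlim_compose[OF filterlim_inverse_at_top_right])
  then have pw: "filterlim (\<lambda>m. norm (x m) powr p) at_top sequentially" by (simp add: powr_minus)
  have "filterlim (\<lambda>m. norm (x m)) at_top sequentially"
    unfolding filterlim_at_top
  proof
    fix Z :: real
    have "\<forall>\<^sub>F m in sequentially. max Z 0 powr p < norm (x m) powr p"
      using pw by (simp add: filterlim_at_top_dense)
    then show "\<forall>\<^sub>F m in sequentially. Z \<le> norm (x m)"
    proof eventually_elim
      case (elim m)
      then have "max Z 0 < norm (x m)" using p by (metis max.cobounded2 norm_ge_zero not_less powr_mono2 less_imp_le)
      then show ?case by simp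
    qed
  qed
  then have "filterlim (\<lambda>m. (1/2) * norm (x m)) at_top sequentially"
    by (intro filterlim_tendsto_pos_mult_at_top[OF tendsto_const]) auto
  then have lim: "filterlim (\<lambda>t. (1/2) * norm (x (nat \<lfloor>t * (4 * C)\<rfloor>))) at_top at_top"
    by (rule filterlim_compose[OF _ filterlim_grid_index])
  show ?case
  proof (rule filterlim_at_top_mono[OF lim])
    show "\<forall>\<^sub>F t in at_top. (1/2) * norm (x (nat \<lfloor>t * (4 * C)\<rfloor>)) \<le> norm (X t w)"
      using eventually_ge_at_top[of 0]
      by eventually_elim (use solution_grid_index(1)[OF elim(2,3)] in \<open>simp add: x_def mult.commute[of _ 2]\<close>)
  qed
qed

end

section \<open>Lyapunov functions for a pair of spirals\<close>

text \<open>This is \<open>4 J + \<epsilon> H - 1/128\<close> with the rotation generator \<open>J\<close> and \<open>H = diag(1, -1)\<close>. For \<open>\<bar>\<epsilon>\<bar> \<le> 1\<close> rotation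
dominates, so the trajectories are elliptic spirals, and \<open>\<epsilon> = 1\<close>, \<open>\<epsilon> = -1\<close> exchange the two axes of the ellipse.\<close>

definition spiral :: "real \<Rightarrow> real^2^2" where
  "spiral \<epsilon> = vector [vector [\<epsilon> - 1/128, -4], vector [4, - \<epsilon> - 1/128]]"

lemma spiral_mult:
  "(spiral \<epsilon> *v x) $ 1 = (\<epsilon> - 1/128) * x $ 1 - 4 * x $ 2"
  "(spiral \<epsilon> *v x) $ 2 = 4 * x $ 1 - (\<epsilon> + 1/128) * x $ 2"
  by (simp_all add: spiral_def matrix_vector_mult_def sum_2 algebra_simps)

lemma norm_spiral_mult:
  assumes "\<bar>\<epsilon>\<bar> \<le> 1" shows "norm (spiral \<epsilon> *v x) \<le> 12 * norm x"
proof -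
  have n: "\<bar>x $ i\<bar> \<le> norm x" for i by (rule component_le_norm_cart)
  have "\<bar>(\<epsilon> - 1/128) * x $ 1\<bar> \<le> 2 * norm x" "\<bar>(\<epsilon> + 1/128) * x $ 2\<bar> \<le> 2 * norm x"
    unfolding abs_mult using assms n by (intro mult_mono; simp)+
  then have "\<bar>(spiral \<epsilon> *v x) $ 1\<bar> \<le> 6 * norm x" "\<bar>(spiral \<epsilon> *v x) $ 2\<bar> \<le> 6 * norm x"
    unfolding spiral_mult using n[of 1] n[of 2] by linarith+
  then show ?thesis using norm_le_l1_cart[of "spiral \<epsilon> *v x"] by (simp add: sum_2)
qed

text \<open>The eigenvalues are \<open>- 1/128 \<plusminus> sqrt (\<epsilon>\<^sup>2 - 16)\<close>, with a purely imaginary root.\<close>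

lemma hurwitz_spiral:
  assumes "\<bar>\<epsilon>\<bar> \<le> 1" shows "hurwitz (spiral \<epsilon>)"
  unfolding hurwitz_def eigenvalue_of_def
proof (intro allI impI)
  fix z assume "\<exists>v::complex^2. v \<noteq> 0 \<and> map_matrix complex_of_real (spiral \<epsilon>) *v v = z *s v"
  then obtain v :: "complex^2" where v: "v \<noteq> 0" "map_matrix complex_of_real (spiral \<epsilon>) *v v = z *s v"
    by blast
  define w where "w = z + 1/128"
  have "(map_matrix complex_of_real (spiral \<epsilon>) *v v) $ 1 = z * v $ 1"
    "(map_matrix complex_of_real (spiral \<epsilon>) *v v) $ 2 = z * v $ 2" using v(2) by simp_all
  then have e: "(of_real \<epsilon> - w) * v $ 1 = 4 * v $ 2" "4 * v $ 1 = (w + of_real \<epsilon>) * v $ 2"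
    by (simp_all add: matrix_vector_mult_def map_matrix_def sum_2 spiral_def w_def algebra_simps)
  have "v $ 2 \<noteq> 0"
  proof
    assume "v $ 2 = 0"
    then have "v = 0" using e(2) by (simp add: vec_eq_iff forall_2)
    then show False using v by simp
  qed
  moreover have "(of_real \<epsilon> - w) * (w + of_real \<epsilon>) * v $ 2 = 16 * v $ 2"
  proof -
    have "(of_real \<epsilon> - w) * (w + of_real \<epsilon>) * v $ 2 = (of_real \<epsilon> - w) * ((w + of_real \<epsilon>) * v $ 2)"
      by (simp only: mult.assoc)
    also have "\<dots> = 4 * ((of_real \<epsilon> - w) * v $ 1)" unfolding e(2)[symmetric] by simp
    also have "\<dots> = 16 * v $ 2" unfolding e(1) by simp
    finally show ?thesis .
  qed
  ultimately have "(of_real \<epsilon> - w) * (w + of_real \<epsilon>) = 16" by simp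
  then have "Re ((of_real \<epsilon> - w) * (w + of_real \<epsilon>)) = 16" "Im ((of_real \<epsilon> - w) * (w + of_real \<epsilon>)) = 0" by simp_all
  then have re: "\<epsilon>\<^sup>2 - (Re w)\<^sup>2 + (Im w)\<^sup>2 = 16" and im: "Re w * Im w = 0"
    by (simp_all add: algebra_simps power2_eq_square)
  have "\<epsilon>\<^sup>2 \<le> 1" using assms by (simp add: abs_square_le_1)
  have "Im w \<noteq> 0"
  proof
    assume "Im w = 0"
    then have "\<epsilon>\<^sup>2 - (Re w)\<^sup>2 = 16" using re by simp
    then show False using \<open>\<epsilon>\<^sup>2 \<le> 1\<close> zero_le_power2[of "Re w"] by linarith
  qed
  then have "Re w = 0" using im by simp
  then show "Re z < 0" by (simp add: w_def)
qed

definition direction_sign :: "2 \<Rightarrow> real" where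
  "direction_sign i = (if i = 0 then 1 else -1)"

lemma direction_sign:
  "\<bar>direction_sign i\<bar> = 1" "(direction_sign i)\<^sup>2 = 1" "direction_sign (1 - i) = - direction_sign i"
  using two_cases[of i] by (auto simp: direction_sign_def)

lemma two_matrices_spiral: "two_matrices (spiral 1) (spiral (-1)) i = spiral (direction_sign i)"
  using two_cases[of i] by (auto simp: direction_sign_def two_matrices_def)

text \<open>In polar coordinates these are \<open>\<rho>\<^sup>2\<close>, \<open>\<rho>\<^sup>2 cos (2 \<theta>)\<close> and \<open>\<rho>\<^sup>2 sin (2 \<theta>)\<close>. They span the
quadratic forms, on which the linear vector fields act by a \<open>3 \<times> 3\<close> matrix (\<open>along_spiral\<close>).\<close>

definition sq_norm :: "real^2 \<Rightarrow> real" where "sq_norm x = (x $ 1)\<^sup>2 + (x $ 2)\<^sup>2"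
definition cos_form :: "real^2 \<Rightarrow> real" where "cos_form x = (x $ 1)\<^sup>2 - (x $ 2)\<^sup>2"
definition sin_form :: "real^2 \<Rightarrow> real" where "sin_form x = 2 * x $ 1 * x $ 2"

definition grad_sq_norm :: "real^2 \<Rightarrow> real^2" where "grad_sq_norm x = vector [2 * x $ 1, 2 * x $ 2]"
definition grad_cos_form :: "real^2 \<Rightarrow> real^2" where "grad_cos_form x = vector [2 * x $ 1, - 2 * x $ 2]"
definition grad_sin_form :: "real^2 \<Rightarrow> real^2" where "grad_sin_form x = vector [2 * x $ 2, 2 * x $ 1]"

lemma sq_norm_eq: "sq_norm x = (norm x)\<^sup>2"
  by (simp add: sq_norm_def norm_vec_def L2_set_def sum_2)

lemma cos_form_sin_form: "(cos_form x)\<^sup>2 + (sin_form x)\<^sup>2 = (sq_norm x)\<^sup>2" "\<bar>cos_form x\<bar> \<le> sq_norm x" "\<bar>sin_form x\<bar> \<le> sq_norm x"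
proof -
  show *: "(cos_form x)\<^sup>2 + (sin_form x)\<^sup>2 = (sq_norm x)\<^sup>2" by (simp add: sq_norm_def cos_form_def sin_form_def power2_eq_square algebra_simps)
  have "0 \<le> sq_norm x" by (simp add: sq_norm_def)
  then show "\<bar>cos_form x\<bar> \<le> sq_norm x" "\<bar>sin_form x\<bar> \<le> sq_norm x"
    using * by (auto intro!: power2_le_imp_le[of "\<bar>_\<bar>"] simp flip: *)
qed

lemma norm_grad:
  "norm (grad_sq_norm x) = 2 * norm x" "norm (grad_cos_form x) = 2 * norm x" "norm (grad_sin_form x) = 2 * norm x"
proof -
  have "2 * norm x = sqrt (4 * sq_norm x)" by (simp add: sq_norm_eq real_sqrt_mult)
  then show "norm (grad_sq_norm x) = 2 * norm x" "norm (grad_cos_form x) = 2 * norm x" "norm (grad_sin_form x) = 2 * norm x"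
    by (simp_all add: grad_sq_norm_def grad_cos_form_def grad_sin_form_def sq_norm_def norm_vec_def L2_set_def sum_2 power_mult_distrib add.commute)
qed

lemma has_derivative_forms:
  "(sq_norm has_derivative (\<lambda>v. grad_sq_norm x \<bullet> v)) (at x)"
  "(cos_form has_derivative (\<lambda>v. grad_cos_form x \<bullet> v)) (at x)"
  "(sin_form has_derivative (\<lambda>v. grad_sin_form x \<bullet> v)) (at x)"
proof -
  note [derivative_intros] = bounded_linear.has_derivative[OF bounded_linear_vec_nth]
  show "(sq_norm has_derivative (\<lambda>v. grad_sq_norm x \<bullet> v)) (at x)" unfolding sq_norm_def[abs_def] grad_sq_norm_def
    by (auto intro!: derivative_eq_intros simp: inner_vec_def sum_2 algebra_simps)
  show "(cos_form has_derivative (\<lambda>v. grad_cos_form x \<bullet> v)) (at x)" unfolding cos_form_def[abs_def] grad_cos_form_def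
    by (auto intro!: derivative_eq_intros simp: inner_vec_def sum_2 algebra_simps)
  show "(sin_form has_derivative (\<lambda>v. grad_sin_form x \<bullet> v)) (at x)" unfolding sin_form_def[abs_def] grad_sin_form_def
    by (auto intro!: derivative_eq_intros simp: inner_vec_def sum_2 algebra_simps)
qed

lemma measurable_forms [measurable]: "sq_norm \<in> borel_measurable borel" "cos_form \<in> borel_measurable borel" "sin_form \<in> borel_measurable borel"
  by (intro borel_measurable_continuous_onI continuous_at_imp_continuous_on ballI has_derivative_continuous[OF has_derivative_forms(1)]
    has_derivative_continuous[OF has_derivative_forms(2)] has_derivative_continuous[OF has_derivative_forms(3)])+

lemma along_spiral:
  "grad_sq_norm x \<bullet> (spiral \<epsilon> *v x) = 2 * \<epsilon> * cos_form x - sq_norm x / 64"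
  "grad_cos_form x \<bullet> (spiral \<epsilon> *v x) = 2 * \<epsilon> * sq_norm x - 8 * sin_form x - cos_form x / 64"
  "grad_sin_form x \<bullet> (spiral \<epsilon> *v x) = 8 * cos_form x - sin_form x / 64"
  by (simp_all add: grad_sq_norm_def grad_cos_form_def grad_sin_form_def inner_vec_def sum_2 spiral_mult sq_norm_def cos_form_def sin_form_def
      power2_eq_square field_simps)

text \<open>The condition on \<open>b\<close> and \<open>c\<close> keeps both forms between 2 and 6 times the squared norm.\<close>

lemma quadratic_lyapunov:
  fixes b c :: "2 \<Rightarrow> real"
  defines "W \<equiv> \<lambda>i x. 4 * sq_norm x + b i * cos_form x + c i * sin_form x"
  defines "G \<equiv> \<lambda>i x. 4 *\<^sub>R grad_sq_norm x + b i *\<^sub>R grad_cos_form x + c i *\<^sub>R grad_sin_form x"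
  assumes bc: "\<And>i. \<bar>b i\<bar> + \<bar>c i\<bar> \<le> 2" and r: "0 < r" and \<beta>: "0 < \<beta>"
    and gen: "\<And>i x. 8 * direction_sign i * cos_form x - sq_norm x / 16 + b i * (2 * direction_sign i * sq_norm x - 8 * sin_form x - cos_form x / 64)
       + c i * (8 * cos_form x - sin_form x / 64) + r * ((b (1 - i) - b i) * cos_form x + (c (1 - i) - c i) * sin_form x) \<le> - \<beta> * W i x"
  shows "switched_lyapunov (two_matrices (spiral 1) (spiral (-1))) 12 r \<beta> 12 W G"
    and "2 * sq_norm x \<le> W i x"
proof -
  have both: "2 * sq_norm x \<le> W i x \<and> W i x \<le> 6 * sq_norm x" for i x
  proof -
    have "\<bar>b i * cos_form x\<bar> \<le> \<bar>b i\<bar> * sq_norm x" "\<bar>c i * sin_form x\<bar> \<le> \<bar>c i\<bar> * sq_norm x"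
      unfolding abs_mult by (intro mult_left_mono cos_form_sin_form; simp)+
    moreover have "(\<bar>b i\<bar> + \<bar>c i\<bar>) * sq_norm x \<le> 2 * sq_norm x" using bc by (intro mult_right_mono) (auto simp: sq_norm_def)
    ultimately show ?thesis unfolding W_def by (simp add: algebra_simps abs_le_iff)
  qed
  then show "2 * sq_norm x \<le> W i x" by blast
  show "switched_lyapunov (two_matrices (spiral 1) (spiral (-1))) 12 r \<beta> 12 W G"
  proof
    fix i j :: 2 and x :: "real^2"
    show "norm (two_matrices (spiral 1) (spiral (- 1)) i *v x) \<le> 12 * norm x"
      unfolding two_matrices_spiral by (rule norm_spiral_mult) (simp add: direction_sign)
    show "W i \<in> borel_measurable borel" unfolding W_def by measurable
    assume x: "x \<noteq> 0"
    then have "0 < sq_norm x" by (simp add: sq_norm_eq)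
    then show "0 < W i x" "W i x \<le> 12 * W j x" using both[where i=i and x=x] both[where i=j and x=x] by linarith+
    show "(W i has_derivative (\<bullet>) (G i x)) (at x)"
      unfolding W_def G_def by (auto intro!: derivative_eq_intros has_derivative_forms simp: inner_add_left)
    have "norm (G i x) \<le> norm (4 *\<^sub>R grad_sq_norm x) + norm (b i *\<^sub>R grad_cos_form x) + norm (c i *\<^sub>R grad_sin_form x)"
      unfolding G_def by (intro norm_triangle_mono order_refl)
    also have "\<dots> = (8 + 2 * (\<bar>b i\<bar> + \<bar>c i\<bar>)) * norm x" by (simp add: norm_grad algebra_simps)
    also have "\<dots> \<le> 12 * norm x" using bc[of i] by (intro mult_right_mono) auto
    finally have "norm (G i x) * norm x \<le> 12 * norm x * norm x" by (rule mult_right_mono) simp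
    also have "\<dots> = 12 * sq_norm x" by (simp add: sq_norm_eq power2_eq_square)
    finally show "norm (G i x) * norm x \<le> 12 * W i x" using both[where i=i and x=x] \<open>0 < sq_norm x\<close> by linarith
    have "G i x \<bullet> (spiral (direction_sign i) *v x) + r * (W (1 - i) x - W i x)
      = 8 * direction_sign i * cos_form x - sq_norm x / 16 + b i * (2 * direction_sign i * sq_norm x - 8 * sin_form x - cos_form x / 64)
       + c i * (8 * cos_form x - sin_form x / 64) + r * ((b (1 - i) - b i) * cos_form x + (c (1 - i) - c i) * sin_form x)"
      unfolding G_def W_def inner_add_left inner_scaleR_left along_spiral by (simp add: algebra_simps)
    also have "\<dots> \<le> - \<beta> * W i x" by (rule gen)
    finally show "G i x \<bullet> (two_matrices (spiral 1) (spiral (- 1)) i *v x) + r * (W (1 - i) x - W i x) \<le> - \<beta> * W i x"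
      unfolding two_matrices_spiral .
  qed (use r \<beta> in auto)
qed

text \<open>For slow switching the form \<open>4 \<rho>\<^sup>2 - \<epsilon> \<rho>\<^sup>2 sin (2 \<theta>)\<close> is taken, which is conserved by \<open>4 J + \<epsilon> H\<close>. Between jumps it
therefore decays at the full rate \<open>1/64\<close>, and a jump multiplies it by at most \<open>5/3\<close>. At switching rates up
to \<open>1/64\<close> the jumps offset at most the fraction \<open>2/3\<close> of that decay.\<close>

lemma slow_lyapunov:
  assumes r: "0 < r" "r \<le> 1/64"
  shows "\<exists>W G. switched_lyapunov (two_matrices (spiral 1) (spiral (-1))) 12 r (1/192) 12 W G \<and>
    (\<forall>i x. (norm x)\<^sup>2 \<le> W i x)"
proof -
  define b :: "2 \<Rightarrow> real" where "b i = 0" for i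
  define c where "c i = - direction_sign i" for i
  have bc: "\<bar>b i\<bar> + \<bar>c i\<bar> \<le> 2" for i by (simp add: b_def c_def direction_sign)
  have gen: "8 * direction_sign i * cos_form x - sq_norm x / 16 + b i * (2 * direction_sign i * sq_norm x - 8 * sin_form x - cos_form x / 64)
       + c i * (8 * cos_form x - sin_form x / 64) + r * ((b (1 - i) - b i) * cos_form x + (c (1 - i) - c i) * sin_form x)
       \<le> - (1/192) * (4 * sq_norm x + b i * cos_form x + c i * sin_form x)" for i x
  proof -
    define e where "e = direction_sign i * sin_form x"
    have "\<bar>e\<bar> \<le> sq_norm x" unfolding e_def abs_mult direction_sign using cos_form_sin_form(3)[of x] by simp
    then have e: "e \<le> sq_norm x" by simp
    have "2 * r * e \<le> 2 * r * sq_norm x" using e r by (intro mult_left_mono) auto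
    also have "\<dots> \<le> (1/32) * sq_norm x" using r by (intro mult_right_mono) (auto simp: sq_norm_def)
    finally have "2 * r * e \<le> (1/32) * sq_norm x" .
    then show ?thesis using e unfolding b_def c_def direction_sign(3) e_def by (simp add: algebra_simps)
  qed
  have "(norm x)\<^sup>2 \<le> 4 * sq_norm x + b i * cos_form x + c i * sin_form x" for i x
    using quadratic_lyapunov(2)[OF bc r(1) _ gen, of x i] zero_le_power2[of "norm x"]
    unfolding sq_norm_eq by linarith
  with quadratic_lyapunov(1)[OF bc r(1) _ gen] show ?thesis by fastforce
qed

text \<open>For fast switching the squared norm decays on average. Its derivative has the oscillating part
\<open>2 \<epsilon> \<rho>\<^sup>2 cos (2 \<theta>)\<close>, which the jumps of the corrector \<open>\<epsilon> \<rho>\<^sup>2 cos (2 \<theta>) / r\<close> cancel; the motion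
between jumps changes the corrector only at a rate of order \<open>1/r\<close>. The form used is 4 times the sum of the two.\<close>

lemma fast_lyapunov:
  assumes r: "2560 \<le> r"
  shows "\<exists>W G. switched_lyapunov (two_matrices (spiral 1) (spiral (-1))) 12 r (1/128) 12 W G \<and>
    (\<forall>i x. (norm x)\<^sup>2 \<le> W i x)"
proof -
  define b where "b i = 4 / r * direction_sign i" for i
  define c :: "2 \<Rightarrow> real" where "c i = 0" for i
  have r0: "0 < r" "4 / r \<le> 1 / 640" using r by (simp_all add: field_simps)
  have b: "\<bar>b i\<bar> = 4 / r" for i using r0 by (simp add: b_def abs_mult direction_sign)
  have bc: "\<bar>b i\<bar> + \<bar>c i\<bar> \<le> 2" for i
    unfolding b c_def abs_zero using r0(2) by linarith
  have gen: "8 * direction_sign i * cos_form x - sq_norm x / 16 + b i * (2 * direction_sign i * sq_norm x - 8 * sin_form x - cos_form x / 64)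
       + c i * (8 * cos_form x - sin_form x / 64) + r * ((b (1 - i) - b i) * cos_form x + (c (1 - i) - c i) * sin_form x)
       \<le> - (1/128) * (4 * sq_norm x + b i * cos_form x + c i * sin_form x)" for i x
  proof -
    have N: "0 \<le> sq_norm x" by (simp add: sq_norm_def)
    have "r * (b (1 - i) - b i) = - 8 * direction_sign i" using r0 by (simp add: b_def direction_sign algebra_simps)
    then have 1: "r * ((b (1 - i) - b i) * cos_form x) = - 8 * direction_sign i * cos_form x" by (simp only: mult.assoc[symmetric])
    have "b i * direction_sign i = 4 / r" using direction_sign(2)[of i] by (simp add: b_def power2_eq_square)
    moreover have "b i * (2 * direction_sign i * sq_norm x) = 2 * ((b i * direction_sign i) * sq_norm x)"
      by (simp only: mult_ac)
    ultimately have 2: "b i * (2 * direction_sign i * sq_norm x) = 2 * (4 / r * sq_norm x)" by (simp only:)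
    have 3: "\<bar>b i * cos_form x\<bar> \<le> 4 / r * sq_norm x" "\<bar>b i * sin_form x\<bar> \<le> 4 / r * sq_norm x"
      unfolding abs_mult b using r0 by (intro mult_left_mono cos_form_sin_form; simp)+
    have 4: "4 / r * sq_norm x \<le> 1 / 640 * sq_norm x" using r0 N by (intro mult_right_mono)
    have "8 * direction_sign i * cos_form x - sq_norm x / 16 + b i * (2 * direction_sign i * sq_norm x - 8 * sin_form x - cos_form x / 64)
       + c i * (8 * cos_form x - sin_form x / 64) + r * ((b (1 - i) - b i) * cos_form x + (c (1 - i) - c i) * sin_form x)
      = - sq_norm x / 16 + 2 * (4 / r * sq_norm x) - 8 * (b i * sin_form x) - (b i * cos_form x) / 64"
      unfolding c_def using 1 2 by (simp add: right_diff_distrib)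
    also have "\<dots> \<le> - (1/128) * (4 * sq_norm x + b i * cos_form x)" 
    proof -
      have "- n / 16 + 2 * t - 8 * v - u / 64 \<le> - (1/128) * (4 * n + u)"
        if "\<bar>u\<bar> \<le> t" "\<bar>v\<bar> \<le> t" "t \<le> 1 / 640 * n" "0 \<le> n" for n t u v :: real
      proof -
        have "- t \<le> u" "- t \<le> v" using that by (simp_all add: abs_le_iff)
        moreover have "- (1/128) * (4 * n + u) = - (n / 32) - u / 128" by (simp add: field_simps)
        ultimately show ?thesis using that(3,4) by linarith
      qed
      from this[OF 3 4 N] show ?thesis .
    qed
    finally show ?thesis by (simp add: c_def)
  qed
  have "(norm x)\<^sup>2 \<le> 4 * sq_norm x + b i * cos_form x + c i * sin_form x" for i x
    using quadratic_lyapunov(2)[OF bc r0(1) _ gen, of x i] zero_le_power2[of "norm x"]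
    unfolding sq_norm_eq by linarith
  with quadratic_lyapunov(1)[OF bc r0(1) _ gen] show ?thesis by fastforce
qed

lemma exp_le_quadratic:
  fixes z :: real assumes "\<bar>z\<bar> \<le> 1/2" shows "exp z \<le> 1 + z + 2 * z\<^sup>2"
proof -
  have "1 - z \<le> exp (- z)" using exp_ge_add_one_self[of "- z"] by simp
  then have "exp z \<le> 1 / (1 - z)" using assms by (simp add: exp_minus field_simps abs_le_iff)
  also have "\<dots> \<le> 1 + z + 2 * z\<^sup>2"
  proof -
    have "0 \<le> z\<^sup>2 * (1 - 2 * z)" using assms by (intro mult_nonneg_nonneg) (auto simp: abs_le_iff)
    then show ?thesis using assms by (simp add: pos_divide_le_eq abs_le_iff algebra_simps power2_eq_square)
  qed
  finally show ?thesis .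
qed

text \<open>Without the decay \<open>-1/128\<close> the doubled angle \<open>\<psi> = 2 \<theta>\<close> and the radius satisfy
\<open>\<psi>' = 8 - 2 \<epsilon> sin \<psi>\<close> and \<open>(ln \<rho>)' = \<epsilon> cos \<psi>\<close>. The function \<open>U\<close> below is \<open>ln \<rho>\<close> with two correctors:
the one linear in \<open>\<epsilon>\<close> cancels \<open>\<epsilon> cos \<psi>\<close> against the drift and the jumps at rate 4, and the one in
\<open>2 \<psi>\<close> removes the oscillation of what remains at second order. The generator applied to \<open>U\<close> is then
\<open>1/16 - 1/128\<close> up to a third-order term of size at most \<open>1/32\<close>: switching at this rate favours the expanding
part of each ellipse, by more than the decay. Finally \<open>exp (- U / 16)\<close>, which is a small negative
power of the radius up to bounded factors, inherits a negative generator since the exponent \<open>1/16\<close> makes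
the second-order term of the exponential smaller than the first-order gain.\<close>

lemma intermediate_lyapunov:
  "\<exists>W G. switched_lyapunov (two_matrices (spiral 1) (spiral (-1))) 12 4 (1/2048) 12 W G \<and>
    (\<forall>i x. x \<noteq> 0 \<longrightarrow> norm x powr - (1/16) \<le> exp 1 * W i x)"
proof -
  define \<kappa> where "\<kappa> x = cos_form x / sq_norm x" for x
  define \<sigma> where "\<sigma> x = sin_form x / sq_norm x" for x
  define g\<kappa> where "g\<kappa> x = (1 / sq_norm x) *\<^sub>R (grad_cos_form x - \<kappa> x *\<^sub>R grad_sq_norm x)" for x
  define g\<sigma> where "g\<sigma> x = (1 / sq_norm x) *\<^sub>R (grad_sin_form x - \<sigma> x *\<^sub>R grad_sq_norm x)" for x
  define U where "U i x = ln (sq_norm x) / 2 + direction_sign i / 16 * (\<kappa> x - \<sigma> x)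
     + 1 / 256 * (2 * \<kappa> x * \<sigma> x + (\<kappa> x)\<^sup>2 - (\<sigma> x)\<^sup>2)" for i x
  define gU where "gU i x = (1 / (2 * sq_norm x)) *\<^sub>R grad_sq_norm x + (direction_sign i / 16) *\<^sub>R (g\<kappa> x - g\<sigma> x)
     + (1 / 256) *\<^sub>R ((2 * \<sigma> x + 2 * \<kappa> x) *\<^sub>R g\<kappa> x + (2 * \<kappa> x - 2 * \<sigma> x) *\<^sub>R g\<sigma> x)" for i x
  define W where "W i x = exp (- (U i x) / 16)" for i x
  define G where "G i x = (- (W i x) / 16) *\<^sub>R gU i x" for i x
  have N: "0 < sq_norm x" if "x \<noteq> 0" for x using that by (simp add: sq_norm_eq)
  have circle: "(\<kappa> x)\<^sup>2 + (\<sigma> x)\<^sup>2 = 1" if "x \<noteq> 0" for x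
    using N[OF that] cos_form_sin_form(1)[of x] by (simp add: \<kappa>_def \<sigma>_def power_divide add_divide_distrib[symmetric])
  have le1: "\<bar>\<kappa> x\<bar> \<le> 1" "\<bar>\<sigma> x\<bar> \<le> 1" if "x \<noteq> 0" for x
    using N[OF that] cos_form_sin_form(2,3)[of x] by (simp_all add: \<kappa>_def \<sigma>_def)
  have diff_sq: "(\<kappa> x - \<sigma> x)\<^sup>2 \<le> 2" if "x \<noteq> 0" for x
    using circle[OF that] zero_le_power2[of "\<kappa> x + \<sigma> x"] by (simp add: power2_sum power2_diff)
  have jump: "U (1 - i) x - U i x = - direction_sign i / 8 * (\<kappa> x - \<sigma> x)" for i x
    by (simp add: U_def direction_sign field_simps)
  have d\<kappa>: "(\<kappa> has_derivative (\<lambda>v. g\<kappa> x \<bullet> v)) (at x)" if "x \<noteq> 0" for x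
    unfolding \<kappa>_def[abs_def]
    by (rule has_derivative_eq_rhs[OF has_derivative_divide'[OF has_derivative_forms(2) has_derivative_forms(1)]])
      (use N[OF that] in \<open>auto simp: g\<kappa>_def \<kappa>_def fun_eq_iff inner_diff_left field_simps\<close>)
  have d\<sigma>: "(\<sigma> has_derivative (\<lambda>v. g\<sigma> x \<bullet> v)) (at x)" if "x \<noteq> 0" for x
    unfolding \<sigma>_def[abs_def]
    by (rule has_derivative_eq_rhs[OF has_derivative_divide'[OF has_derivative_forms(3) has_derivative_forms(1)]])
      (use N[OF that] in \<open>auto simp: g\<sigma>_def \<sigma>_def fun_eq_iff inner_diff_left field_simps\<close>)
  have dln: "((\<lambda>x. ln (sq_norm x)) has_derivative (\<lambda>v. (1 / sq_norm x) *\<^sub>R grad_sq_norm x \<bullet> v)) (at x)" if "x \<noteq> 0" for x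
    by (rule has_derivative_eq_rhs[OF has_derivative_ln[OF N[OF that] has_derivative_forms(1)]]) (simp add: fun_eq_iff divide_inverse)
  have dU: "(U i has_derivative (\<lambda>v. gU i x \<bullet> v)) (at x)" if "x \<noteq> 0" for i x
    unfolding U_def[abs_def] gU_def
    by (rule dln[OF that] d\<kappa>[OF that] d\<sigma>[OF that] derivative_eq_intros refl | simp)+
      (simp add: fun_eq_iff inner_add_left inner_diff_left field_simps power2_eq_square)
  have slope: "gU i x \<bullet> (spiral (direction_sign i) *v x) + 4 * (U (1 - i) x - U i x) \<ge> 3 / 128" if x: "x \<noteq> 0" for i x
  proof -
    define e k s where "e = direction_sign i" and "k = \<kappa> x" and "s = \<sigma> x"
    have ks: "k\<^sup>2 + s\<^sup>2 = 1" "\<bar>s\<bar> \<le> 1" "e\<^sup>2 = 1" "\<bar>e\<bar> = 1"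
      using circle[OF x] le1[OF x] by (simp_all add: k_def s_def e_def direction_sign)
    have a0: "grad_sq_norm x \<bullet> (spiral e *v x) / sq_norm x = 2 * e * k - 1 / 64"
      unfolding along_spiral k_def \<kappa>_def using N[OF x] by (simp add: field_simps)
    have "g\<kappa> x \<bullet> (spiral e *v x) = 2 * e - 8 * s - k / 64 - k * (2 * e * k - 1 / 64)"
      unfolding g\<kappa>_def inner_scaleR_left inner_diff_left a0[symmetric] along_spiral k_def s_def \<kappa>_def \<sigma>_def
      using N[OF x] by (simp add: field_simps)
    also have "\<dots> = - s * (8 - 2 * e * s)" using ks by algebra
    finally have a1: "g\<kappa> x \<bullet> (spiral e *v x) = - s * (8 - 2 * e * s)" .
    have a2: "g\<sigma> x \<bullet> (spiral e *v x) = k * (8 - 2 * e * s)"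
      unfolding g\<sigma>_def inner_scaleR_left inner_diff_left along_spiral k_def s_def \<kappa>_def \<sigma>_def
      using N[OF x] by (simp add: field_simps)
    have "gU i x \<bullet> (spiral e *v x) = (2 * e * k - 1 / 64) / 2 + e / 16 * (- s * (8 - 2 * e * s) - k * (8 - 2 * e * s))
       + 1 / 256 * ((2 * s + 2 * k) * (- s * (8 - 2 * e * s)) + (2 * k - 2 * s) * (k * (8 - 2 * e * s)))"
      unfolding gU_def inner_add_left inner_scaleR_left inner_diff_left a1 a2 a0[symmetric]
      by (simp add: e_def k_def s_def)
    then have "gU i x \<bullet> (spiral e *v x) + 4 * (U (1 - i) x - U i x)
      = (2 * e * k - 1 / 64) / 2 + e / 16 * (- s * (8 - 2 * e * s) - k * (8 - 2 * e * s))
       + 1 / 256 * ((2 * s + 2 * k) * (- s * (8 - 2 * e * s)) + (2 * k - 2 * s) * (k * (8 - 2 * e * s)))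
       + 4 * (- e / 8 * (k - s))" unfolding jump by (simp add: e_def k_def s_def)
    \<comment> \<open>All terms of first and second order cancel except the constant; the last summand is of third order.\<close>
    also have "\<dots> = 1 / 16 - 1 / 128 - 1 / 64 * (e * s * (k\<^sup>2 - s\<^sup>2 - 2 * k * s))" using ks by algebra
    also have "\<dots> \<ge> 3 / 128"
    proof -
      have "\<bar>k\<^sup>2 - s\<^sup>2 - 2 * k * s\<bar> \<le> 2"
        using ks(1) zero_le_power2[of "k + s"] zero_le_power2[of "k - s"] zero_le_power2[of k] zero_le_power2[of s]
        unfolding power2_sum power2_diff by linarith
      then have "\<bar>e * s * (k\<^sup>2 - s\<^sup>2 - 2 * k * s)\<bar> \<le> 1 * 2"
        unfolding abs_mult using ks by (intro mult_mono) auto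
      then show ?thesis by (simp add: abs_le_iff)
    qed
    finally show ?thesis by (simp add: e_def)
  qed
  have gU_bound: "norm (gU i x) * norm x \<le> 2" if x: "x \<noteq> 0" for i x
  proof -
    have nx: "norm x * norm x = sq_norm x" by (simp add: sq_norm_eq power2_eq_square)
    have 0: "norm (grad_sq_norm x) / sq_norm x * norm x = 2" using N[OF x] by (simp add: norm_grad nx mult.assoc)
    have "norm (grad_cos_form x - \<kappa> x *\<^sub>R grad_sq_norm x) \<le> 2 * norm x + \<bar>\<kappa> x\<bar> * (2 * norm x)"
      using norm_triangle_ineq4[of "grad_cos_form x" "\<kappa> x *\<^sub>R grad_sq_norm x"] by (simp add: norm_grad)
    also have "\<dots> \<le> 2 * norm x + 1 * (2 * norm x)" using le1[OF x] by (intro add_mono mult_right_mono) auto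
    finally have "norm (grad_cos_form x - \<kappa> x *\<^sub>R grad_sq_norm x) * norm x \<le> 4 * norm x * norm x" by (intro mult_right_mono) auto
    then have 1: "norm (g\<kappa> x) * norm x \<le> 4" using N[OF x] nx by (simp add: g\<kappa>_def pos_divide_le_eq mult.assoc)
    have "norm (grad_sin_form x - \<sigma> x *\<^sub>R grad_sq_norm x) \<le> 2 * norm x + \<bar>\<sigma> x\<bar> * (2 * norm x)"
      using norm_triangle_ineq4[of "grad_sin_form x" "\<sigma> x *\<^sub>R grad_sq_norm x"] by (simp add: norm_grad)
    also have "\<dots> \<le> 2 * norm x + 1 * (2 * norm x)" using le1[OF x] by (intro add_mono mult_right_mono) auto
    finally have "norm (grad_sin_form x - \<sigma> x *\<^sub>R grad_sq_norm x) * norm x \<le> 4 * norm x * norm x" by (intro mult_right_mono) auto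
    then have 2: "norm (g\<sigma> x) * norm x \<le> 4" using N[OF x] nx by (simp add: g\<sigma>_def pos_divide_le_eq mult.assoc)
    have c: "\<bar>2 * \<sigma> x + 2 * \<kappa> x\<bar> \<le> 4" "\<bar>2 * \<kappa> x - 2 * \<sigma> x\<bar> \<le> 4" using le1[OF x] by (simp_all add: abs_le_iff)
    have "norm (gU i x) \<le> norm (grad_sq_norm x) / sq_norm x / 2 + (norm (g\<kappa> x) + norm (g\<sigma> x)) / 16
      + (\<bar>2 * \<sigma> x + 2 * \<kappa> x\<bar> * norm (g\<kappa> x) + \<bar>2 * \<kappa> x - 2 * \<sigma> x\<bar> * norm (g\<sigma> x)) / 256"
      unfolding gU_def
    proof (intro norm_triangle_mono)
      show "norm ((1 / (2 * sq_norm x)) *\<^sub>R grad_sq_norm x) \<le> norm (grad_sq_norm x) / sq_norm x / 2" using N[OF x] by simp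
      show "norm ((direction_sign i / 16) *\<^sub>R (g\<kappa> x - g\<sigma> x)) \<le> (norm (g\<kappa> x) + norm (g\<sigma> x)) / 16"
        using norm_triangle_ineq4[of "g\<kappa> x" "g\<sigma> x"] by (simp add: direction_sign)
      show "norm ((1 / 256) *\<^sub>R ((2 * \<sigma> x + 2 * \<kappa> x) *\<^sub>R g\<kappa> x + (2 * \<kappa> x - 2 * \<sigma> x) *\<^sub>R g\<sigma> x))
        \<le> (\<bar>2 * \<sigma> x + 2 * \<kappa> x\<bar> * norm (g\<kappa> x) + \<bar>2 * \<kappa> x - 2 * \<sigma> x\<bar> * norm (g\<sigma> x)) / 256"
        using norm_triangle_ineq[of "(2 * \<sigma> x + 2 * \<kappa> x) *\<^sub>R g\<kappa> x" "(2 * \<kappa> x - 2 * \<sigma> x) *\<^sub>R g\<sigma> x"] by simp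
    qed
    also have "\<dots> \<le> norm (grad_sq_norm x) / sq_norm x / 2 + (norm (g\<kappa> x) + norm (g\<sigma> x)) / 16
      + (4 * norm (g\<kappa> x) + 4 * norm (g\<sigma> x)) / 256"
      using c by (intro add_mono divide_right_mono mult_right_mono order_refl) auto
    finally have "norm (gU i x) * norm x \<le> (norm (grad_sq_norm x) / sq_norm x / 2 + (norm (g\<kappa> x) + norm (g\<sigma> x)) / 16
      + (4 * norm (g\<kappa> x) + 4 * norm (g\<sigma> x)) / 256) * norm x" by (rule mult_right_mono) simp
    also have "\<dots> = (norm (grad_sq_norm x) / sq_norm x * norm x) / 2 + (norm (g\<kappa> x) * norm x + norm (g\<sigma> x) * norm x) / 16
      + (4 * (norm (g\<kappa> x) * norm x) + 4 * (norm (g\<sigma> x) * norm x)) / 256" by (simp add: field_simps)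
    also have "\<dots> \<le> 2" unfolding 0 using 1 2 by (simp add: field_simps)
    finally show ?thesis .
  qed
  have ratio: "W (1 - i) x = W i x * exp (direction_sign i / 128 * (\<kappa> x - \<sigma> x))" for i x
    unfolding W_def exp_add[symmetric] using jump[of i x] by (simp add: field_simps)
  have ratio_bound: "\<bar>direction_sign i / 128 * (\<kappa> x - \<sigma> x)\<bar> \<le> 1 / 2" if "x \<noteq> 0" for i x
    using le1[OF that] by (simp add: abs_mult direction_sign abs_le_iff)
  have "switched_lyapunov (two_matrices (spiral 1) (spiral (-1))) 12 4 (1/2048) 12 W G"
  proof
    fix i j :: 2 and x :: "real^2"
    show "norm (two_matrices (spiral 1) (spiral (- 1)) i *v x) \<le> 12 * norm x"
      unfolding two_matrices_spiral by (rule norm_spiral_mult) (simp add: direction_sign)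
    show "W i \<in> borel_measurable borel" unfolding W_def U_def \<kappa>_def \<sigma>_def by measurable
    assume x: "x \<noteq> 0"
    show W0: "0 < W i x" by (simp add: W_def)
    show "(W i has_derivative (\<bullet>) (G i x)) (at x)"
      unfolding W_def[abs_def] G_def
    proof (rule has_derivative_eq_rhs[OF has_derivative_exp])
      show "((\<lambda>x. - U i x / 16) has_derivative (\<lambda>v. - (gU i x \<bullet> v) / 16)) (at x)"
        by (auto intro!: derivative_eq_intros dU[OF x])
    qed (simp add: fun_eq_iff)
    have "norm (G i x) * norm x = W i x / 16 * (norm (gU i x) * norm x)" using W0 by (simp add: G_def)
    also have "\<dots> \<le> W i x / 16 * 2" using gU_bound[OF x] W0 by (intro mult_left_mono) auto
    finally show "norm (G i x) * norm x \<le> 12 * W i x" using W0 by simp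
    show "W i x \<le> 12 * W j x"
    proof (cases "i = j")
      case True
      then show ?thesis using W0 by simp
    next
      case False
      then have i: "i = 1 - j" using two_cases[of i] two_cases[of j] by auto
      have "exp (direction_sign j / 128 * (\<kappa> x - \<sigma> x)) \<le> exp 1"
        using ratio_bound[OF x, of j] by (simp add: abs_le_iff)
      also have "\<dots> \<le> 12" using exp_le by simp
      finally have "W j x * exp (direction_sign j / 128 * (\<kappa> x - \<sigma> x)) \<le> W j x * 12"
        by (rule mult_left_mono) (simp add: W_def)
      then show ?thesis unfolding i ratio by simp
    qed
    define z where "z = direction_sign i / 128 * (\<kappa> x - \<sigma> x)"
    define u where "u = gU i x \<bullet> (spiral (direction_sign i) *v x)"
    have "z\<^sup>2 = (\<kappa> x - \<sigma> x)\<^sup>2 / 16384"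
      by (simp add: z_def power_mult_distrib power_divide direction_sign)
    then have z2: "z\<^sup>2 \<le> 1 / 8192" using diff_sq[OF x] by simp
    have "exp z \<le> 1 + z + 2 * z\<^sup>2" using ratio_bound[OF x, of i] unfolding z_def by (rule exp_le_quadratic)
    moreover have "u - 64 * z \<ge> 3 / 128" using slope[OF x, of i] unfolding u_def z_def jump by simp
    ultimately have "- u / 16 + 4 * (exp z - 1) \<le> - (1 / 2048)" using z2 by simp
    then have "W i x * (- u / 16 + 4 * (exp z - 1)) \<le> W i x * - (1 / 2048)"
      using W0 by (intro mult_left_mono) auto
    then show "G i x \<bullet> (two_matrices (spiral 1) (spiral (- 1)) i *v x) + 4 * (W (1 - i) x - W i x) \<le> - (1 / 2048) * W i x"
      unfolding two_matrices_spiral ratio G_def inner_scaleR_left u_def[symmetric] z_def[symmetric]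
      by (simp add: algebra_simps)
  qed auto
  moreover have "norm x powr - (1/16) \<le> exp 1 * W i x" if x: "x \<noteq> 0" for i x
  proof -
    have "ln (sq_norm x) = 2 * ln (norm x)" using x by (simp add: sq_norm_eq ln_realpow)
    then have U: "U i x = ln (norm x) + direction_sign i / 16 * (\<kappa> x - \<sigma> x)
       + 1 / 256 * (2 * \<kappa> x * \<sigma> x + (\<kappa> x)\<^sup>2 - (\<sigma> x)\<^sup>2)" by (simp add: U_def)
    have "2 * \<kappa> x * \<sigma> x + (\<kappa> x)\<^sup>2 - (\<sigma> x)\<^sup>2 \<le> 2"
      using circle[OF x] zero_le_power2[of "\<kappa> x - \<sigma> x"] zero_le_power2[of "\<sigma> x"]
      unfolding power2_diff by linarith
    moreover have "l + a + 1 / 256 * q \<le> l + 16" if "q \<le> 2" "a \<le> 4" for l a q :: real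
      using that by linarith
    moreover have "direction_sign i / 16 * (\<kappa> x - \<sigma> x) \<le> 4"
      using ratio_bound[OF x, of i] by (simp add: abs_le_iff)
    ultimately have "U i x \<le> ln (norm x) + 16" unfolding U by blast
    then have "exp (- (1/16) * ln (norm x)) \<le> exp 1 * exp (- (U i x) / 16)"
      unfolding exp_add[symmetric] by simp
    then show ?thesis using x by (simp add: powr_def W_def)
  qed
  ultimately show ?thesis by blast
qed

section \<open>Stability and instability\<close>

lemma switched_process_initial_nonzero:
  fixes \<mu> :: "((real^'n) \<times> 'e::finite) measure"
  assumes sp: "switched_process M A L \<mu> X J" and nz: "measure \<mu> ({0} \<times> UNIV) = 0"
  shows "AE w in M. X 0 w \<noteq> 0"
proof -
  interpret prob_space M using sp by (simp add: switched_process_def)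
  have [measurable]: "X 0 \<in> borel_measurable M" "J 0 \<in> M \<rightarrow>\<^sub>M count_space UNIV"
    using sp by (auto simp: switched_process_def jump_markov_process_def)
  have \<mu>: "\<mu> = distr M (borel \<Otimes>\<^sub>M count_space UNIV) (\<lambda>w. (X 0 w, J 0 w))"
    using sp by (simp add: switched_process_def)
  have "({0} \<times> UNIV :: ((real^'n) \<times> 'e) set) \<in> sets (borel \<Otimes>\<^sub>M count_space UNIV)"
    by (intro pair_measureI) auto
  then have "prob ((\<lambda>w. (X 0 w, J 0 w)) -` ({0} \<times> UNIV) \<inter> space M) = 0"
    using nz unfolding \<mu> by (subst (asm) measure_distr) auto
  also have "(\<lambda>w. (X 0 w, J 0 w)) -` ({0} \<times> UNIV) \<inter> space M = {w \<in> space M. X 0 w = 0}" by auto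
  finally show ?thesis by (subst (asm) prob_eq_0) auto
qed

theorem mainTheorem5:
  fixes \<mu> :: "((real^2) \<times> 2) measure"
  assumes "prob_space \<mu>"
    and "sets \<mu> = sets (borel \<Otimes>\<^sub>M count_space UNIV)"
    and "integrable \<mu> (\<lambda>(x, i). norm x)"
    and "measure \<mu> ({0} \<times> UNIV) = 0"
  shows "\<exists>(A0 :: real^2^2) (A1 :: real^2^2) (a :: real) (b :: real).
    0 < a \<and> a < b \<and>
    hurwitz A0 \<and> hurwitz A1 \<and>
    hurwitz ((1/2) *\<^sub>R (A0 + A1)) \<and>
    (\<forall>r>0. r \<notin> {a<..<b} \<longrightarrow>
      (\<forall>(M :: 'w measure) X J.
        switched_process M (two_matrices A0 A1) (r *\<^sub>R switch_matrix) \<mu> X J \<longrightarrow>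
        (AE w in M. ((\<lambda>t. norm (X t w)) \<longlongrightarrow> 0) at_top))) \<and>
    (\<exists>r\<in>{a<..<b}.
      (\<forall>(M :: 'w measure) X J.
        switched_process M (two_matrices A0 A1) (r *\<^sub>R switch_matrix) \<mu> X J \<longrightarrow>
        (AE w in M. filterlim (\<lambda>t. norm (X t w)) at_top at_top)))"
proof (intro exI conjI allI impI)
  show "(0::real) < 1/64" "(1/64::real) < 2560" by simp_all
  show "hurwitz (spiral 1)" "hurwitz (spiral (-1))" by (simp_all add: hurwitz_spiral)
  have "(1/2) *\<^sub>R (spiral 1 + spiral (-1)) = spiral 0"
    by (simp add: vec_eq_iff forall_2 spiral_def)
  then show "hurwitz ((1/2) *\<^sub>R (spiral 1 + spiral (-1)))" by (simp add: hurwitz_spiral)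
next
  fix r :: real and M :: "'w measure" and X J
  assume r: "0 < r" "r \<notin> {1/64<..<2560}"
    and sp: "switched_process M (two_matrices (spiral 1) (spiral (-1))) (r *\<^sub>R switch_matrix) \<mu> X J"
  have "r \<le> 1/64 \<or> 2560 \<le> r" using r by auto
  then obtain W G \<beta> where
    "switched_lyapunov (two_matrices (spiral 1) (spiral (-1))) 12 r \<beta> 12 W G"
    and lower: "\<forall>i x. (norm x)\<^sup>2 \<le> W i x"
    using slow_lyapunov[OF r(1)] fast_lyapunov[of r] by metis
  then interpret switched_lyapunov "two_matrices (spiral 1) (spiral (-1))" 12 r \<beta> 12 W G by simp
  show "AE w in M. ((\<lambda>t. norm (X t w)) \<longlongrightarrow> 0) at_top"
  proof (rule norm_tendsto_0)
    show "AE w in M. X 0 w \<noteq> 0" by (rule switched_process_initial_nonzero[OF sp assms(4)])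
    show "(norm x)\<^sup>2 \<le> W i x" for i x using lower by blast
  qed (use sp in \<open>auto simp: switched_process_def\<close>)
next
  obtain W G where
    "switched_lyapunov (two_matrices (spiral 1) (spiral (-1))) 12 4 (1/2048) 12 W G"
    and lower: "\<forall>i x. x \<noteq> 0 \<longrightarrow> norm x powr - (1/16) \<le> exp 1 * W i x"
    using intermediate_lyapunov by blast
  then interpret switched_lyapunov "two_matrices (spiral 1) (spiral (-1))" 12 4 "1/2048" 12 W G by simp
  show "\<exists>r\<in>{1/64<..<2560}. \<forall>(M :: 'w measure) X J.
      switched_process M (two_matrices (spiral 1) (spiral (-1))) (r *\<^sub>R switch_matrix) \<mu> X J \<longrightarrow>
      (AE w in M. filterlim (\<lambda>t. norm (X t w)) at_top at_top)"
  \<comment> \<open>The rate 4 equals the angular velocity of the mean rotation, so that a jump typically follows a turn by one radian.\<close>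
  proof (intro bexI[of _ 4] allI impI)
    fix M :: "'w measure" and X J
    assume sp: "switched_process M (two_matrices (spiral 1) (spiral (-1))) (4 *\<^sub>R switch_matrix) \<mu> X J"
    show "AE w in M. filterlim (\<lambda>t. norm (X t w)) at_top at_top"
    proof (rule norm_tendsto_at_top)
      show "AE w in M. X 0 w \<noteq> 0" by (rule switched_process_initial_nonzero[OF sp assms(4)])
      show "norm x powr - (1/16) \<le> exp 1 * W i x" if "x \<noteq> 0" for i x using lower that by blast
    qed (use sp in \<open>auto simp: switched_process_def\<close>)
  qed simp
qed

end
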